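(* There is a constant $C$ such that for every $N$ and all binary strings $a,b,c$ of length at most $N$ there exists a binary string $f$ such that (1) $\mathrm{KS}(b\mid a,f)\le C\log N$, and (2) $\bigl|\mathrm{KS}(b\mid c,f)-\min\{\mathrm{KS}(a\mid c),\mathrm{KS}(b\mid c)\}\bigr|\le C\log N$.
   Context: $\mathrm{KS}(u\mid v)$ denotes conditional Kolmogorov complexity with respect to a fixed optimal programming language; $\mathrm{KS}(u\mid v,w)$ is complexity conditional on (an encoding of) the pair $\langle v,w\rangle$.
   Formalization: The claim is proved for every N ≥ 2 instead of every N: for N = 0 the logarithm is undefined, and for N = 1 the bound C log N is 0, which fails for an optimal language in which the empty program produces no output. *)

theory Defs
  imports Complex_Main
begin

datatype recf = Z | S | Id nat | Cn recf "recf list" | Pr recf recf | Mn recf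

inductive eval :: "recf \<Rightarrow> nat list \<Rightarrow> nat \<Rightarrow> bool" where
  eval_Z: "eval Z xs 0"
| eval_S: "eval S (x # xs) (Suc x)"
| eval_Id: "i < length xs \<Longrightarrow> eval (Id i) xs (xs ! i)"
| eval_Cn: "list_all2 (\<lambda>f y. eval f xs y) fs ys \<Longrightarrow> eval g ys r \<Longrightarrow> eval (Cn g fs) xs r"
| eval_Pr0: "eval f xs r \<Longrightarrow> eval (Pr f g) (0 # xs) r"
| eval_PrS: "eval (Pr f g) (n # xs) r \<Longrightarrow> eval g (n # r # xs) r' \<Longrightarrow> eval (Pr f g) (Suc n # xs) r'"
| eval_Mn: "eval f (n # xs) 0 \<Longrightarrow> (\<forall>m<n. \<exists>r. eval f (m # xs) r \<and> r > 0) \<Longrightarrow> eval (Mn f) xs n"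

fun nat_of_bits :: "bool list \<Rightarrow> nat" where
  "nat_of_bits [] = 0"
| "nat_of_bits (b # bs) = 2 * nat_of_bits bs + (if b then 2 else 1)"

text \<open>Self-delimiting encoding of a pair of strings: each bit of v doubled, then 01, then w.\<close>
definition pair_str :: "bool list \<Rightarrow> bool list \<Rightarrow> bool list" where
  "pair_str v w = concat (map (\<lambda>x. [x, x]) v) @ [False, True] @ w"

text \<open>A description mode (decompressor) maps a program p and a condition y to an output.
  It is computable if it is computed by a partial recursive function via nat_of_bits.\<close>
definition computable_mode :: "(bool list \<Rightarrow> bool list \<Rightarrow> bool list option) \<Rightarrow> bool" where
  "computable_mode D \<longleftrightarrow> (\<exists>f. \<forall>p y z.
      eval f [nat_of_bits p, nat_of_bits y] (nat_of_bits z) \<longleftrightarrow> D p y = Some z)"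

definition optimal_mode :: "(bool list \<Rightarrow> bool list \<Rightarrow> bool list option) \<Rightarrow> bool" where
  "optimal_mode D \<longleftrightarrow> computable_mode D \<and>
     (\<forall>D'. computable_mode D' \<longrightarrow> (\<exists>c. \<forall>p y x. D' p y = Some x \<longrightarrow>
        (\<exists>q. D q y = Some x \<and> length q \<le> length p + c)))"

definition KS :: "(bool list \<Rightarrow> bool list \<Rightarrow> bool list option) \<Rightarrow> bool list \<Rightarrow> bool list \<Rightarrow> nat" where
  "KS D x y = (LEAST n. \<exists>p. length p = n \<and> D p y = Some x)"

end

theory Submission
  imports Defs "HOL-Library.Nat_Bijection"
begin

text \<open>The string \<open>f\<close> is the table of a function \<open>F\<close> on strings of length at most \<open>N\<close> with \<open>F(a) = b\<close>. Any such
  table makes \<open>b\<close> simple given \<open>a, f\<close> and gives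
  \<open>KS(b|c,f) \<le> min (KS(a|c), KS(b|c)) + O(1)\<close>. For the converse let \<open>t\<close> be slightly smaller than this
  minimum, and call a pair \<open>(a',b')\<close> bad if \<open>KS(b'|c,f) < t\<close> for every table \<open>f\<close> with \<open>F(a') = b'\<close>.
  A matching of bad pairs is contained in a single table, so it has fewer than \<open>2^t\<close> pairs.
  Given \<open>c, N, t\<close>, the bad pairs can be enumerated and a maximal matching can be selected greedily.
  If \<open>(a,b)\<close> were bad, then by maximality \<open>a\<close> or \<open>b\<close> would occur in that matching, hence be described
  given \<open>c\<close> by its index together with \<open>N\<close> and \<open>t\<close>, that is by \<open>t + O(log N)\<close> bits, which is less
  than the minimum.\<close>

section \<open>Total recursive functions\<close>

inductive_cases eval_ZE: "eval Z xs r"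
inductive_cases eval_SE: "eval S xs r"
inductive_cases eval_IdE: "eval (Id i) xs r"
inductive_cases eval_CnE: "eval (Cn g fs) xs r"
inductive_cases eval_Pr0E: "eval (Pr f g) (0 # xs) r"
inductive_cases eval_PrSE: "eval (Pr f g) (Suc n # xs) r"
inductive_cases eval_PrE: "eval (Pr f g) xs r"
inductive_cases eval_MnE: "eval (Mn f) xs r"

lemma eval_Z_iff: "eval Z xs r \<longleftrightarrow> r = 0"
  by (auto intro: eval_Z elim: eval_ZE)

lemma eval_S_iff: "eval S xs r \<longleftrightarrow> xs \<noteq> [] \<and> r = Suc (hd xs)"
  by (cases xs) (auto intro: eval_S elim: eval_SE)

lemma eval_Id_iff: "eval (Id i) xs r \<longleftrightarrow> i < length xs \<and> r = xs ! i"
  by (auto intro: eval_Id elim: eval_IdE)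

lemma eval_Cn_iff:
  "eval (Cn g fs) xs r \<longleftrightarrow> (\<exists>ys. list_all2 (\<lambda>f y. eval f xs y) fs ys \<and> eval g ys r)"
  by (auto intro: eval_Cn elim: eval_CnE)

lemma eval_Mn_iff:
  "eval (Mn f) xs n \<longleftrightarrow> eval f (n # xs) 0 \<and> (\<forall>m<n. \<exists>r. eval f (m # xs) r \<and> r > 0)"
  by (auto intro: eval_Mn elim: eval_MnE)

lemma eval_Pr_0_iff: "eval (Pr f g) (0 # xs) r \<longleftrightarrow> eval f xs r"
  by (auto intro: eval_Pr0 elim: eval_Pr0E)

lemma eval_Pr_Suc_iff:
  "eval (Pr f g) (Suc n # xs) r \<longleftrightarrow> (\<exists>q. eval (Pr f g) (n # xs) q \<and> eval g (n # q # xs) r)"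
  by (auto intro: eval_PrS elim: eval_PrSE)

lemma not_eval_Pr_Nil: "\<not> eval (Pr f g) [] r"
  by (auto elim: eval_PrE)

lemma list_all2_map_upt:
  "list_all2 R (map g [0..<n]) ys \<longleftrightarrow> (\<exists>h. ys = map h [0..<n] \<and> (\<forall>i<n. R (g i) (h i)))"
proof
  assume R: "list_all2 R (map g [0..<n]) ys"
  then have "length ys = n" by (auto dest: list_all2_lengthD)
  then have "ys = map ((!) ys) [0..<n]" by (auto simp: map_nth)
  with R show "\<exists>h. ys = map h [0..<n] \<and> (\<forall>i<n. R (g i) (h i))"
    by (intro exI[of _ "(!) ys"]) (auto simp: list_all2_conv_all_nth)
qed (auto simp: list_all2_conv_all_nth)

text \<open>Composition quantifies over the list of intermediate values; when every component is
  total and single-valued, only one such list is possible.\<close>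

lemma eval_Cn_map:
  assumes "\<And>i y. i < n \<Longrightarrow> eval (f i) xs y = (y = F i)"
  shows "eval (Cn g (map f [0..<n])) xs r = eval g (map F [0..<n]) r"
proof -
  have "(\<forall>i<n. eval (f i) xs (h i)) \<longleftrightarrow> map h [0..<n] = map F [0..<n]" for h
    using assms by auto
  then show ?thesis unfolding eval_Cn_iff list_all2_map_upt by metis
qed

text \<open>Arguments are taken from an infinite environment, of which a function or predicate inspects
  only a bounded initial segment; this removes all arity bookkeeping.\<close>
definition rfun :: "((nat \<Rightarrow> nat) \<Rightarrow> nat) \<Rightarrow> bool" where
  "rfun F \<longleftrightarrow> (\<exists>k f. \<forall>m e r. k \<le> m \<longrightarrow> eval f (map e [0..<m]) r = (r = F e))"

text \<open>Truth is coded by 0 because \<open>Mn\<close> searches for a zero.\<close>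

definition rdec :: "((nat \<Rightarrow> nat) \<Rightarrow> bool) \<Rightarrow> bool" where
  "rdec P \<longleftrightarrow> rfun (\<lambda>e. if P e then 0 else 1)"

text \<open>Although infinitely many functions are substituted, \<open>G\<close> reads only its
  first \<open>k\<close> arguments, so a finite composition suffices.\<close>

lemma rfun_subst:
  assumes G: "rfun G" and F: "\<And>i. rfun (F i)"
  shows "rfun (\<lambda>e. G (\<lambda>i. F i e))"
proof -
  obtain k g where g: "\<And>m e r. k \<le> m \<Longrightarrow> eval g (map e [0..<m]) r = (r = G e)"
    using G unfolding rfun_def by blast
  have "\<forall>i. \<exists>k f. \<forall>m e r. k \<le> m \<longrightarrow> eval f (map e [0..<m]) r = (r = F i e)"
    using F unfolding rfun_def by blast
  then obtain l f where f: "\<And>i m e r. l i \<le> m \<Longrightarrow> eval (f i) (map e [0..<m]) r = (r = F i e)"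
    by metis
  \<comment> \<open>The sum of the bounds \<open>l i\<close> is a common bound for all
    components.\<close>
  have "eval (Cn g (map f [0..<k])) (map e [0..<m]) r = (r = G (\<lambda>i. F i e))"
    if m: "(\<Sum>i<k. l i) \<le> m" for m e r
  proof -
    have "l i \<le> m" if "i < k" for i
      using member_le_sum[of i "{..<k}" l] that m by auto
    then have "eval (Cn g (map f [0..<k])) (map e [0..<m]) r = eval g (map (\<lambda>i. F i e) [0..<k]) r"
      by (intro eval_Cn_map f) simp
    then show ?thesis by (simp add: g)
  qed
  then show ?thesis unfolding rfun_def by blast
qed

lemma rfun_var: "rfun (\<lambda>e. e i)"
  unfolding rfun_def by (intro exI[of _ "Suc i"] exI[of _ "Id i"]) (auto simp: eval_Id_iff)

lemma map_upt_Suc_conv: "map e [0..<Suc m] = e 0 # map (\<lambda>i. e (Suc i)) [0..<m]"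
  by (simp add: upt_conv_Cons map_Suc_upt[symmetric] o_def del: upt_Suc)

lemma rfun_Suc_var: "rfun (\<lambda>e. Suc (e 0))"
proof -
  have "eval S (map e [0..<m]) r = (r = Suc (e 0))" if "1 \<le> m" for m e r
    using that by (cases m) (auto simp: eval_S_iff map_upt_Suc_conv simp del: upt_Suc)
  then show ?thesis unfolding rfun_def by blast
qed

lemma rfun_Suc: "rfun A \<Longrightarrow> rfun (\<lambda>e. Suc (A e))"
  using rfun_subst[OF rfun_Suc_var, of "\<lambda>_. A"] by simp

lemma rfun_const: "rfun (\<lambda>e. n)"
proof (induction n)
  case 0
  show ?case unfolding rfun_def by (intro exI[of _ 0] exI[of _ Z]) (auto simp: eval_Z_iff)
qed (rule rfun_Suc)

lemma rfun_case_nat: "rfun A \<Longrightarrow> (\<And>i. rfun (F i)) \<Longrightarrow> rfun (\<lambda>e. case_nat (A e) (\<lambda>i. F i e) j)"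
  by (cases j) auto

lemma rfun_rec:
  assumes F: "rfun F" and G: "rfun (\<lambda>e. G (e 0) (e (Suc 0)) (\<lambda>i. e (Suc (Suc i))))" and N: "rfun N"
  shows "rfun (\<lambda>e. rec_nat (F e) (\<lambda>n r. G n r e) (N e))"
proof -
  obtain k f where f: "\<And>m e r. k \<le> m \<Longrightarrow> eval f (map e [0..<m]) r = (r = F e)"
    using F unfolding rfun_def by blast
  obtain l g where g: "\<And>m e r. l \<le> m \<Longrightarrow>
      eval g (map e [0..<m]) r = (r = G (e 0) (e (Suc 0)) (\<lambda>i. e (Suc (Suc i))))"
    using G unfolding rfun_def by blast
  have *: "eval (Pr f g) (n # map e [0..<m]) r = (r = rec_nat (F e) (\<lambda>n r. G n r e) n)"
    if "k \<le> m" "l \<le> Suc (Suc m)" for m e n r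
  proof (induction n arbitrary: r)
    case 0
    show ?case using that by (simp add: eval_Pr_0_iff f)
  next
    case (Suc n)
    have "eval g (n # q # map e [0..<m]) r = (r = G n q e)" for q r
      using g[OF that(2), of "case_nat n (case_nat q e)" r]
      by (simp add: map_upt_Suc_conv del: upt_Suc)
    then show ?case by (simp add: eval_Pr_Suc_iff Suc.IH)
  qed
  \<comment> \<open>The recursion first runs on variable 0; \<open>N\<close> is substituted for that
    variable afterwards.\<close>
  have "eval (Pr f g) (map e [0..<m]) r
      = (r = rec_nat (F (\<lambda>i. e (Suc i))) (\<lambda>n r. G n r (\<lambda>i. e (Suc i))) (e 0))"
    if "Suc (max k l) \<le> m" for m e r
    using that * by (cases m) (auto simp: map_upt_Suc_conv simp del: upt_Suc)
  then have H: "rfun (\<lambda>e. rec_nat (F (\<lambda>i. e (Suc i))) (\<lambda>n r. G n r (\<lambda>i. e (Suc i))) (e 0))"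
    unfolding rfun_def by blast
  show ?thesis
    using rfun_subst[OF H, of "\<lambda>j e. case_nat (N e) (\<lambda>i. e i) j"] N
    by (simp add: rfun_case_nat rfun_var)
qed

lemma rfun_add: "rfun A \<Longrightarrow> rfun B \<Longrightarrow> rfun (\<lambda>e. A e + B e)"
proof -
  assume "rfun A" "rfun B"
  then have "rfun (\<lambda>e. rec_nat (A e) (\<lambda>n r. Suc r) (B e))"
    by (intro rfun_rec rfun_Suc rfun_var)
  moreover have "rec_nat a (\<lambda>n r. Suc r) b = a + b" for a b by (induction b) auto
  ultimately show ?thesis by simp
qed

lemma rfun_mult: "rfun A \<Longrightarrow> rfun B \<Longrightarrow> rfun (\<lambda>e. A e * B e)"
proof -
  assume A: "rfun A" and B: "rfun B"
  have "rfun (\<lambda>e. A (\<lambda>i. e (Suc (Suc i))))" by (rule rfun_subst[OF A]) (rule rfun_var)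
  then have "rfun (\<lambda>e. rec_nat 0 (\<lambda>n r. r + A e) (B e))"
    by (intro rfun_rec rfun_add rfun_var rfun_const B)
  moreover have "rec_nat 0 (\<lambda>n r. r + a) b = a * b" for a b :: nat by (induction b) auto
  ultimately show ?thesis by simp
qed

lemma rfun_power: "rfun A \<Longrightarrow> rfun B \<Longrightarrow> rfun (\<lambda>e. A e ^ B e)"
proof -
  assume A: "rfun A" and B: "rfun B"
  have "rfun (\<lambda>e. A (\<lambda>i. e (Suc (Suc i))))" by (rule rfun_subst[OF A]) (rule rfun_var)
  then have "rfun (\<lambda>e. rec_nat 1 (\<lambda>n r. A e * r) (B e))"
    by (intro rfun_rec rfun_mult rfun_var rfun_const B)
  moreover have "rec_nat 1 (\<lambda>n r. a * r) b = a ^ b" for a b :: nat by (induction b) auto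
  ultimately show ?thesis by (simp del: One_nat_def)
qed

lemma rfun_diff: "rfun A \<Longrightarrow> rfun B \<Longrightarrow> rfun (\<lambda>e. A e - B e)"
proof -
  assume A: "rfun A" and B: "rfun B"
  \<comment> \<open>The predecessor is a recursion that returns its counter; subtraction iterates
    it. Variable 1 is used because it holds the previous value in that iteration.\<close>
  have "rfun (\<lambda>e. rec_nat 0 (\<lambda>n r. n) (e 1))"
    by (intro rfun_rec rfun_var rfun_const)
  moreover have "rec_nat 0 (\<lambda>n r. n) b = b - 1" for b by (induction b) auto
  ultimately have "rfun (\<lambda>e. e 1 - 1)" by simp
  then have "rfun (\<lambda>e. rec_nat (A e) (\<lambda>n r. r - 1) (B e))"
    by (intro rfun_rec A B) simp
  moreover have "rec_nat a (\<lambda>n r. r - 1) b = a - b" for a b by (induction b) auto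
  ultimately show ?thesis by simp
qed

section \<open>Closure properties of decidable predicates\<close>

lemma rdec_eq_0: "rfun A \<Longrightarrow> rdec (\<lambda>e. A e = 0)"
proof -
  assume "rfun A"
  then have "rfun (\<lambda>e. rec_nat 0 (\<lambda>n r. 1) (A e))"
    by (intro rfun_rec rfun_const)
  moreover have "rec_nat 0 (\<lambda>n r. 1) b = (if b = 0 then 0 else 1 :: nat)" for b by (cases b) auto
  ultimately show ?thesis by (simp add: rdec_def del: One_nat_def)
qed

lemma rdec_cong0: "rfun A \<Longrightarrow> (\<And>e. P e \<longleftrightarrow> A e = 0) \<Longrightarrow> rdec P"
  using rdec_eq_0[of A] by presburger

lemma rdec_conj: "rdec P \<Longrightarrow> rdec Q \<Longrightarrow> rdec (\<lambda>e. P e \<and> Q e)"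
  by (rule rdec_cong0[of "\<lambda>e. (if P e then 0 else 1) + (if Q e then 0 else 1)"])
     (auto simp: rdec_def intro: rfun_add)

lemma rdec_not: "rdec P \<Longrightarrow> rdec (\<lambda>e. \<not> P e)"
  by (rule rdec_cong0[of "\<lambda>e. 1 - (if P e then 0 else 1)"])
     (auto simp: rdec_def intro!: rfun_diff rfun_const)

lemma rdec_disj: "rdec P \<Longrightarrow> rdec Q \<Longrightarrow> rdec (\<lambda>e. P e \<or> Q e)"
  using rdec_not[OF rdec_conj[OF rdec_not rdec_not, of P Q]] by simp

lemma rdec_le: "rfun A \<Longrightarrow> rfun B \<Longrightarrow> rdec (\<lambda>e. A e \<le> B e)"
  by (rule rdec_cong0[of "\<lambda>e. A e - B e"]) (auto intro: rfun_diff)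

lemma rdec_less: "rfun A \<Longrightarrow> rfun B \<Longrightarrow> rdec (\<lambda>e. A e < B e)"
  using rdec_not[OF rdec_le, of B A] by (simp add: not_le)

lemma rdec_eq: "rfun A \<Longrightarrow> rfun B \<Longrightarrow> rdec (\<lambda>e. A e = B e)"
  using rdec_conj[OF rdec_le rdec_le, of A B B A] by (simp add: eq_iff)

lemma rdec_subst: "rdec P \<Longrightarrow> (\<And>i. rfun (F i)) \<Longrightarrow> rdec (\<lambda>e. P (\<lambda>i. F i e))"
  unfolding rdec_def by (rule rfun_subst)

text \<open>The 0/1 codes of the instances are summed; the sum vanishes exactly if all instances
  hold.\<close>

lemma rdec_ball:
  assumes P: "rdec (\<lambda>e. P (e 0) (\<lambda>i. e (Suc i)))" and N: "rfun N"
  shows "rdec (\<lambda>e. \<forall>i<N e. P i e)"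
proof (rule rdec_cong0)
  have "rdec (\<lambda>e. P (e 0) (\<lambda>i. e (Suc (Suc i))))"
    using rdec_subst[OF P, of "\<lambda>i e. case_nat (e 0) (\<lambda>i. e (Suc (Suc i))) i"]
    by (simp add: rfun_case_nat rfun_var)
  then show "rfun (\<lambda>e. rec_nat 0 (\<lambda>n r. r + (if P n e then 0 else 1)) (N e))"
    by (intro rfun_rec rfun_const rfun_add rfun_var N) (simp add: rdec_def)
  have "(\<forall>i<n. P i e) \<longleftrightarrow> rec_nat 0 (\<lambda>n r. r + (if P n e then 0 else 1)) n = (0::nat)" for n e
    by (induction n) (auto simp: less_Suc_eq)
  then show "(\<forall>i<N e. P i e) \<longleftrightarrow> rec_nat 0 (\<lambda>n r. r + (if P n e then 0 else 1)) (N e) = (0::nat)" for e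
    .
qed

lemma rdec_bex:
  assumes P: "rdec (\<lambda>e. P (e 0) (\<lambda>i. e (Suc i)))" and N: "rfun N"
  shows "rdec (\<lambda>e. \<exists>i<N e. P i e)"
  using rdec_not[OF rdec_ball[OF rdec_not[OF P] N]] by simp

text \<open>An unbounded search over candidate values stops at \<open>F e\<close>, the only value
  that passes the test. This replaces explicit programs for division and for the
  projections.\<close>

lemma rfun_graph:
  assumes P: "rdec (\<lambda>e. F (\<lambda>i. e (Suc i)) = e 0)"
  shows "rfun F"
proof -
  obtain k f where f: "\<And>m e r. k \<le> m \<Longrightarrow>
      eval f (map e [0..<m]) r = (r = (if F (\<lambda>i. e (Suc i)) = e 0 then 0 else 1))"
    using P unfolding rfun_def rdec_def by blast
  have f': "eval f (x # map e [0..<m]) r = (r = (if F e = x then 0 else 1))" if "k \<le> m" for m e x r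
    using f[of "Suc m" "case_nat x e" r] that
    by (simp add: map_upt_Suc_conv del: upt_Suc)
  have "eval (Mn f) (map e [0..<m]) r = (r = F e)" if "k \<le> m" for m e r
    by (auto simp: eval_Mn_iff f'[OF that] split: if_splits)
  then show ?thesis unfolding rfun_def by blast
qed

lemma rfun_shift: "rfun A \<Longrightarrow> rfun (\<lambda>e. A (\<lambda>i. e (Suc i)))"
  by (rule rfun_subst[of A "\<lambda>i e. e (Suc i)"]) (auto intro: rfun_var)

lemmas rfun_arith = rfun_var rfun_const rfun_Suc rfun_add rfun_mult rfun_power rfun_diff
lemmas rdec_basic = rdec_conj rdec_disj rdec_not rdec_le rdec_less rdec_eq rdec_ball rdec_bex

section \<open>Division, pairing and digit tables\<close>

lemma rfun_div: "rfun A \<Longrightarrow> rfun B \<Longrightarrow> rfun (\<lambda>e. A e div B e)"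
proof -
  assume A: "rfun A" and B: "rfun B"
  \<comment> \<open>The first disjunct is the convention for division by zero; the second cannot
    hold when \<open>b = 0\<close>.\<close>
  have *: "a div b = q \<longleftrightarrow> b = 0 \<and> q = 0 \<or> b * q \<le> a \<and> a < b * Suc q" for a b q :: nat
  proof (cases "b = 0")
    case False
    then show ?thesis
      by (metis div_nat_eqI dividend_less_times_div mult.commute mult_Suc_right neq0_conv
          times_div_less_eq_dividend add.commute)
  qed auto
  show ?thesis
    by (rule rfun_graph, unfold *) (intro rdec_basic rfun_arith rfun_shift A B)
qed

lemma rfun_mod: "rfun A \<Longrightarrow> rfun B \<Longrightarrow> rfun (\<lambda>e. A e mod B e)"
  unfolding modulo_nat_def by (intro rfun_diff rfun_mult rfun_div)

lemma rfun_prod_encode: "rfun A \<Longrightarrow> rfun B \<Longrightarrow> rfun (\<lambda>e. prod_encode (A e, B e))"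
  unfolding prod_encode_def triangle_def by simp (intro rfun_arith rfun_div)

definition pfst :: "nat \<Rightarrow> nat" where "pfst z = fst (prod_decode z)"
definition psnd :: "nat \<Rightarrow> nat" where "psnd z = snd (prod_decode z)"

lemma pfst_encode [simp]: "pfst (prod_encode (x, y)) = x"
  and psnd_encode [simp]: "psnd (prod_encode (x, y)) = y"
  and encode_pfst_psnd [simp]: "prod_encode (pfst z, psnd z) = z"
  by (simp_all add: pfst_def psnd_def)

lemma rfun_pfst: "rfun A \<Longrightarrow> rfun (\<lambda>e. pfst (A e))"
proof -
  assume A: "rfun A"
  have *: "pfst z = x \<longleftrightarrow> (\<exists>y<Suc z. prod_encode (x, y) = z)" for x z
    by (metis encode_pfst_psnd le_prod_encode_2 less_Suc_eq_le pfst_encode)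
  show ?thesis
    by (rule rfun_graph, unfold *)
      (intro rdec_basic rfun_arith rfun_shift rfun_prod_encode A)
qed

lemma rfun_psnd: "rfun A \<Longrightarrow> rfun (\<lambda>e. psnd (A e))"
proof -
  assume A: "rfun A"
  have *: "psnd z = y \<longleftrightarrow> (\<exists>x<Suc z. prod_encode (x, y) = z)" for y z
    by (metis encode_pfst_psnd le_prod_encode_1 less_Suc_eq_le psnd_encode)
  show ?thesis
    by (rule rfun_graph, unfold *)
      (intro rdec_basic rfun_arith rfun_shift rfun_prod_encode A)
qed

text \<open>The number \<open>u\<close>, read in base \<open>B\<close>, tabulates a function with values below \<open>B\<close>.\<close>
definition dig :: "nat \<Rightarrow> nat \<Rightarrow> nat \<Rightarrow> nat" where "dig B u i = u div B ^ i mod B"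

lemma rfun_dig: "rfun A \<Longrightarrow> rfun B \<Longrightarrow> rfun C \<Longrightarrow> rfun (\<lambda>e. dig (A e) (B e) (C e))"
  unfolding dig_def by (intro rfun_mod rfun_div rfun_power)

text \<open>The induction splits off the lowest digit \<open>h 0\<close>. The bound on
  \<open>u\<close> matters later: it makes quantification over all tables a bounded one.\<close>

lemma ex_dig:
  assumes "\<And>i. i < n \<Longrightarrow> h i < B"
  shows "\<exists>u < B ^ n. \<forall>i<n. dig B u i = h i"
  using assms
proof (induction n arbitrary: h)
  case 0
  then show ?case by auto
next
  case (Suc n)
  obtain u where u: "u < B ^ n" "\<And>i. i < n \<Longrightarrow> dig B u i = h (Suc i)"
    using Suc.IH[of "\<lambda>i. h (Suc i)"] Suc.prems by auto
  have h: "h 0 < B" using Suc.prems by auto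
  have "h 0 + B * u < B * Suc u" using h by simp
  also have "\<dots> \<le> B * B ^ n" using u(1) by (intro mult_le_mono2) simp
  finally have "h 0 + B * u < B ^ Suc n" by simp
  moreover have "dig B (h 0 + B * u) i = h i" if "i < Suc n" for i
  proof (cases i)
    case (Suc j)
    have "(h 0 + B * u) div (B * B ^ j) = u div B ^ j"
      using h by (simp add: div_mult2_eq)
    then show ?thesis using Suc that u(2)[of j] by (simp add: dig_def)
  qed (use h in \<open>simp add: dig_def\<close>)
  ultimately show ?case by blast
qed

lemmas rfun_intros = rfun_arith rfun_div rfun_mod rfun_prod_encode rfun_pfst rfun_psnd rfun_dig

section \<open>Recursively enumerable predicates\<close>

definition re :: "((nat \<Rightarrow> nat) \<Rightarrow> bool) \<Rightarrow> bool" where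
  "re P \<longleftrightarrow> (\<exists>T. rdec (\<lambda>e. T (e 0) (\<lambda>i. e (Suc i))) \<and> (\<forall>e. P e = (\<exists>s. T s e)))"

lemma reI: "rdec (\<lambda>e. T (e 0) (\<lambda>i. e (Suc i))) \<Longrightarrow> (\<And>e. P e \<longleftrightarrow> (\<exists>s. T s e)) \<Longrightarrow> re P"
  unfolding re_def by blast

lemma rdec_subst1:
  assumes "rdec (\<lambda>e. T (e 0) (\<lambda>i. e (Suc i)))" "rfun A" "\<And>i. rfun (F i)"
  shows "rdec (\<lambda>e. T (A e) (\<lambda>i. F i e))"
  using rdec_subst[OF assms(1), of "\<lambda>j e. case_nat (A e) (\<lambda>i. F i e) j"] assms(2,3)
  by (simp add: rfun_case_nat)

lemma re_rdec: "rdec P \<Longrightarrow> re P"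
  by (rule reI[of "\<lambda>s e. P e"]) (auto intro: rdec_subst[of P "\<lambda>i e. e (Suc i)"] rfun_var)

lemma re_subst:
  assumes P: "re P" and F: "\<And>i. rfun (F i)"
  shows "re (\<lambda>e. P (\<lambda>i. F i e))"
proof -
  obtain T where T: "rdec (\<lambda>e. T (e 0) (\<lambda>i. e (Suc i)))" "\<And>e. P e = (\<exists>s. T s e)"
    using P unfolding re_def by blast
  show ?thesis
    by (rule reI[of "\<lambda>s e. T s (\<lambda>i. F i e)"])
      (simp_all add: T rdec_subst1[OF T(1)] rfun_var F rfun_shift)
qed

lemma ex_pfst_psnd: "(\<exists>w. \<Phi> (pfst w) (psnd w)) \<longleftrightarrow> (\<exists>x y. \<Phi> x y)"
  by (metis pfst_encode psnd_encode)

text \<open>The value \<open>y\<close> and the witness for it are searched for together, as one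
  coded pair.\<close>

lemma re_ex:
  assumes P: "re (\<lambda>e. P (e 0) (\<lambda>i. e (Suc i)))"
  shows "re (\<lambda>e. \<exists>y. P y e)"
proof -
  obtain T where T: "rdec (\<lambda>e. T (e 0) (\<lambda>i. e (Suc i)))"
    "\<And>e. P (e 0) (\<lambda>i. e (Suc i)) = (\<exists>s. T s e)"
    using P unfolding re_def by blast
  have PT: "P y e = (\<exists>s. T s (case_nat y e))" for y e
    using T(2)[of "case_nat y e"] by simp
  have "rdec (\<lambda>e. T (pfst (e 0)) (\<lambda>j. case_nat (psnd (e 0)) (\<lambda>i. e (Suc i)) j))"
    by (intro rdec_subst1[OF T(1)] rfun_case_nat rfun_intros)
  then show ?thesis
    by (rule reI[of "\<lambda>w e. T (pfst w) (case_nat (psnd w) e)"])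
      (use ex_pfst_psnd[of "\<lambda>s y. T s (case_nat y _)"] PT in blast)
qed

lemma re_conj: 
  assumes "re P" "re Q"
  shows "re (\<lambda>e. P e \<and> Q e)"
proof -
  obtain T where T: "rdec (\<lambda>e. T (e 0) (\<lambda>i. e (Suc i)))" "\<And>e. P e = (\<exists>s. T s e)"
    using assms(1) unfolding re_def by blast
  obtain T' where T': "rdec (\<lambda>e. T' (e 0) (\<lambda>i. e (Suc i)))" "\<And>e. Q e = (\<exists>s. T' s e)"
    using assms(2) unfolding re_def by blast
  have "rdec (\<lambda>e. T (pfst (e 0)) (\<lambda>i. e (Suc i)) \<and> T' (psnd (e 0)) (\<lambda>i. e (Suc i)))"
    by (intro rdec_conj rdec_subst1[OF T(1)] rdec_subst1[OF T'(1)] rfun_intros)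
  then show ?thesis
    by (rule reI[of "\<lambda>w e. T (pfst w) e \<and> T' (psnd w) e"])
      (use ex_pfst_psnd[of "\<lambda>s s'. T s _ \<and> T' s' _"] T(2) T'(2) in blast)
qed

lemma re_disj: 
  assumes "re P" "re Q"
  shows "re (\<lambda>e. P e \<or> Q e)"
proof -
  obtain T where T: "rdec (\<lambda>e. T (e 0) (\<lambda>i. e (Suc i)))" "\<And>e. P e = (\<exists>s. T s e)"
    using assms(1) unfolding re_def by blast
  obtain T' where T': "rdec (\<lambda>e. T' (e 0) (\<lambda>i. e (Suc i)))" "\<And>e. Q e = (\<exists>s. T' s e)"
    using assms(2) unfolding re_def by blast
  show ?thesis
    by (rule reI[of "\<lambda>s e. T s e \<or> T' s e"]) (auto simp: T T' intro: rdec_disj)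
qed

text \<open>Finitely many instances have witnesses below one common bound \<open>w\<close>, and
  \<open>w\<close> serves as the single witness.\<close>

lemma re_ball:
  assumes P: "re (\<lambda>e. P (e 0) (\<lambda>i. e (Suc i)))" and N: "rfun N"
  shows "re (\<lambda>e. \<forall>i<N e. P i e)"
proof -
  obtain T where T: "rdec (\<lambda>e. T (e 0) (\<lambda>i. e (Suc i)))"
    "\<And>e. P (e 0) (\<lambda>i. e (Suc i)) = (\<exists>s. T s e)"
    using P unfolding re_def by blast
  have PT: "P y e = (\<exists>s. T s (case_nat y e))" for y e
    using T(2)[of "case_nat y e"] by simp
  \<comment> \<open>Positions 0, 1, 2 hold the witness \<open>s\<close>, the index \<open>i\<close>
    and the bound \<open>w\<close>; the environment starts at 3.\<close>
  have "rdec (\<lambda>e. T (e 0) (\<lambda>j. case_nat (e (Suc 0)) (\<lambda>i. e (Suc (Suc (Suc i)))) j))"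
    by (intro rdec_subst1[OF T(1)] rfun_case_nat rfun_intros)
  then have "rdec (\<lambda>e. \<forall>i<N (\<lambda>i. e (Suc i)). \<exists>s<e 0. T s (case_nat i (\<lambda>i. e (Suc i))))"
    by (intro rdec_ball rdec_bex rfun_intros rfun_shift N)
  then show ?thesis
  proof (rule reI[of "\<lambda>w e. \<forall>i<N e. \<exists>s<w. T s (case_nat i e)"])
    fix e
    have "\<exists>w. \<forall>i<n. \<exists>s<w. T s (case_nat i e)" if "\<forall>i<n. \<exists>s. T s (case_nat i e)" for n
      using that
    proof (induction n)
      case (Suc n)
      then obtain w s where "\<forall>i<n. \<exists>s<w. T s (case_nat i e)" "T s (case_nat n e)" by auto
      then have "\<forall>i<Suc n. \<exists>s'<max w (Suc s). T s' (case_nat i e)"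
        by (metis less_Suc_eq less_max_iff_disj lessI)
      then show ?case by blast
    qed auto
    then show "(\<forall>i<N e. P i e) = (\<exists>w. \<forall>i<N e. \<exists>s<w. T s (case_nat i e))"
      unfolding PT by blast
  qed
qed

lemma re_const: "re (\<lambda>e. b)"
  using re_rdec[OF rdec_eq[OF rfun_const rfun_const, of 0 "if b then 0 else 1"]] by (cases b) auto

lemma re_2:
  assumes "re (\<lambda>e. P (e 0) (e 1))" "rfun A" "rfun B" shows "re (\<lambda>e. P (A e) (B e))"
  using re_subst[OF assms(1), of "\<lambda>j e. case_nat (A e) (\<lambda>_. B e) j"] assms(2,3)
  by (simp add: rfun_case_nat)

lemma re_3:
  assumes "re (\<lambda>e. P (e 0) (e 1) (e 2))" "rfun A" "rfun B" "rfun C"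
  shows "re (\<lambda>e. P (A e) (B e) (C e))"
  using re_subst[OF assms(1), of "\<lambda>j e. case_nat (A e) (\<lambda>j. case_nat (B e) (\<lambda>_. C e) j) j"] assms(2-)
  by (simp add: rfun_case_nat numeral_2_eq_2)

lemmas re_basic = re_conj re_disj re_ex re_ball

text \<open>Only the values \<open>h 0, ..., h (N e)\<close> matter, and they are the digits of a
  number \<open>u\<close> in a base \<open>K\<close>, so the quantifier over functions becomes one
  over two numbers.\<close>

lemma re_ex_seq:
  assumes P: "re (\<lambda>e. P (e 0) (e (Suc 0)) (e (Suc (Suc 0))) (\<lambda>i. e (Suc (Suc (Suc i)))))"
    and "rfun A" "rfun B" "rfun N"
  shows "re (\<lambda>e. \<exists>h. h 0 = A e \<and> (\<forall>i<N e. P i (h i) (h (Suc i)) e) \<and> h (N e) = B e)"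
proof -
  have P': "re (\<lambda>e. P (X e) (Y e) (V e) (\<lambda>i. F i e))"
    if "rfun X" "rfun Y" "rfun V" "\<And>i. rfun (F i)" for X Y V F
    using re_subst[OF P, of
        "\<lambda>j e. case_nat (X e) (\<lambda>j. case_nat (Y e) (\<lambda>j. case_nat (V e) (\<lambda>i. F i e) j) j) j"]
    by (simp add: rfun_case_nat that)
  have *: "(\<exists>h. h 0 = a \<and> (\<forall>i<n. P i (h i) (h (Suc i)) e) \<and> h n = b) \<longleftrightarrow>
      (\<exists>K u. dig K u 0 = a \<and> (\<forall>i<n. P i (dig K u i) (dig K u (Suc i)) e) \<and> dig K u n = b)"
    (is "?L \<longleftrightarrow> ?R") for n a b e
  proof
    assume ?L
    then obtain h where h: "h 0 = a" "\<forall>i<n. P i (h i) (h (Suc i)) e" "h n = b" by blast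
    \<comment> \<open>The base exceeds the sum of all values, hence each of them.\<close>
    have "h i < Suc (\<Sum>i<Suc n. h i)" if "i < Suc n" for i
      using member_le_sum[of i "{..<Suc n}" h] that by (simp del: sum.lessThan_Suc)
    from ex_dig[of "Suc n" h, OF this]
    obtain K u where "\<forall>i<Suc n. dig K u i = h i" by blast
    then have "dig K u 0 = a \<and> (\<forall>i<n. P i (dig K u i) (dig K u (Suc i)) e) \<and> dig K u n = b"
      using h by simp
    then show ?R by blast
  qed blast
  show ?thesis
    unfolding * 
    by (intro re_basic P' re_rdec[OF rdec_eq] rfun_intros rfun_shift assms(2-4))
qed

lemma re_rtranclp:
  assumes P: "re (\<lambda>e. P (e 0) (e (Suc 0)) (\<lambda>i. e (Suc (Suc i))))"
    and A: "rfun A" and B: "rfun B"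
  shows "re (\<lambda>e. (\<lambda>x y. P x y e)\<^sup>*\<^sup>* (A e) (B e))"
proof -
  have *: "(\<lambda>x y. P x y e)\<^sup>*\<^sup>* a b \<longleftrightarrow> (\<exists>n h. h 0 = a \<and> (\<forall>i<n. P (h i) (h (Suc i)) e) \<and> h n = b)" for a b e
    unfolding rtranclp_power relpowp_fun_conv by blast
  have "re (\<lambda>e. P (e (Suc 0)) (e (Suc (Suc 0))) (\<lambda>i. e (Suc (Suc (Suc (Suc i))))))"
    using re_subst[OF P, of
        "\<lambda>j e. case_nat (e (Suc 0)) (\<lambda>j. case_nat (e (Suc (Suc 0))) (\<lambda>i. e (Suc (Suc (Suc (Suc i))))) j) j"]
    by (simp add: rfun_case_nat rfun_var)
  then show ?thesis
    unfolding * by (intro re_ex re_ex_seq rfun_var rfun_shift A B)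
qed

text \<open>Pairs of a witness and a value are searched through; totality of \<open>F\<close> makes
  the search stop, and the second component of the first hit is the value.\<close>

lemma re_rfun:
  assumes "re (\<lambda>e. F (\<lambda>i. e (Suc i)) = e 0)"
  shows "rfun F"
proof -
  obtain T where T: "rdec (\<lambda>e. T (e 0) (\<lambda>i. e (Suc i)))"
    "\<And>e. (F (\<lambda>i. e (Suc i)) = e 0) = (\<exists>s. T s e)"
    using assms unfolding re_def by blast
  have T2: "(F e = y) = (\<exists>s. T s (case_nat y e))" for y e
    using T(2)[of "case_nat y e"] by simp
  have T': "rdec (\<lambda>e. T (pfst (A e)) (\<lambda>j. case_nat (psnd (A e)) (\<lambda>i. G i e) j))"
    if "rfun A" "\<And>i. rfun (G i)" for A G
    by (intro rdec_subst1[OF T(1)] rfun_case_nat rfun_intros that)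
  define M where "M e = (LEAST w. T (pfst w) (case_nat (psnd w) e))" for e
  have ex: "\<exists>w. T (pfst w) (case_nat (psnd w) e)" for e
    using ex_pfst_psnd[of "\<lambda>s y. T s (case_nat y e)"] T2[of e] by blast
  have M: "T (pfst (M e)) (case_nat (psnd (M e)) e)" for e
    unfolding M_def by (rule LeastI_ex[OF ex])
  have graph: "M e = w \<longleftrightarrow> T (pfst w) (case_nat (psnd w) e) \<and>
      (\<forall>v<w. \<not> T (pfst v) (case_nat (psnd v) e))" for e w
    using M[of e] not_less_Least[of _ "\<lambda>w. T (pfst w) (case_nat (psnd w) e)"]
    unfolding M_def by (meson linorder_neqE_nat)
  have "rfun M"
    by (rule rfun_graph, unfold graph) (intro rdec_basic T' rfun_var)
  then have "rfun (\<lambda>e. psnd (M e))" by (rule rfun_psnd)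
  moreover have "psnd (M e) = F e" for e using M[of e] T2[of e "psnd (M e)"] by auto
  ultimately show ?thesis by simp
qed

text \<open>Among all \<open>y\<close> related to \<open>x\<close>, the one that occurs in the least
  successful pair of witness and value is kept. Minimality is decidable because the test on pairs
  is.\<close>

lemma re_uniformize:
  assumes "re (\<lambda>e. Q (e 0) (e 1))"
  shows "\<exists>Q'. re (\<lambda>e. Q' (e 0) (e 1)) \<and> (\<forall>y x. Q' y x \<longrightarrow> Q y x) \<and>
    (\<forall>y z x. Q' y x \<longrightarrow> Q' z x \<longrightarrow> y = z) \<and> (\<forall>y x. Q y x \<longrightarrow> (\<exists>z. Q' z x))"
proof -
  obtain T where T: "rdec (\<lambda>e. T (e 0) (\<lambda>i. e (Suc i)))" "\<And>e. Q (e 0) (e 1) = (\<exists>s. T s e)"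
    using assms unfolding re_def by blast
  define t where "t w x = T (pfst w) (case_nat (psnd w) (\<lambda>_. x))" for w x
  have t: "rdec (\<lambda>e. t (A e) (B e))" if "rfun A" "rfun B" for A B
    unfolding t_def using that
    by (intro rdec_subst1[OF T(1)] rfun_case_nat rfun_intros)
  have Qt: "Q y x \<longleftrightarrow> (\<exists>s. t (prod_encode (s, y)) x)" for y x
    using T(2)[of "case_nat y (\<lambda>_. x)"] by (simp add: t_def)
  define Q' where "Q' y x \<longleftrightarrow>
    (\<exists>s. t (prod_encode (s, y)) x \<and> (\<forall>v<prod_encode (s, y). \<not> t v x))" for y x
  have "re (\<lambda>e. Q' (e 0) (e 1))"
    unfolding Q'_def by (intro re_ex re_rdec rdec_basic t rfun_intros)
  moreover have "Q' y x \<longrightarrow> Q y x" for y x unfolding Q'_def Qt by blast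
  moreover have "y = z" if "Q' y x" "Q' z x" for x y z
    using that unfolding Q'_def by (metis linorder_neqE_nat psnd_encode)
  moreover have "\<exists>z. Q' z x" if "Q y x" for x y
  proof -
    define w where "w = (LEAST w. t w x)"
    have "t w x" unfolding w_def using that Qt by (metis LeastI)
    moreover have "\<forall>v<w. \<not> t v x" unfolding w_def using not_less_Least by blast
    ultimately have "Q' (psnd w) x" unfolding Q'_def
      by (intro exI[of _ "pfst w"]) simp
    then show ?thesis by blast
  qed
  ultimately show ?thesis by blast
qed

section \<open>Program evaluation is recursively enumerable, and enumerable partial functions have
  programs\<close>

lemma re_ex_prefix:
  assumes "re P"
  shows "re (\<lambda>e. \<exists>h. P (\<lambda>i. if i < m then h i else e (i - m)))"
  using assms
proof (induction m arbitrary: P)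
  case 0
  then show ?case by simp
next
  case (Suc m)
  have "re (\<lambda>e. \<exists>y. P (case_nat y e))" 
  proof (rule re_ex)
    have "case_nat (e 0) (\<lambda>i. e (Suc i)) = e" for e :: "nat \<Rightarrow> nat"
      by (rule ext) (simp split: nat.split)
    then show "re (\<lambda>e. P (case_nat (e 0) (\<lambda>i. e (Suc i))))" by (simp add: Suc.prems)
  qed
  from Suc.IH[OF this]
  have *: "re (\<lambda>e. \<exists>h y. P (case_nat y (\<lambda>i. if i < m then h i else e (i - m))))" .
  have "(\<exists>h y. P (case_nat y (\<lambda>i. if i < m then h i else e (i - m))))
    = (\<exists>h. P (\<lambda>i. if i < Suc m then h i else e (i - Suc m)))" for e :: "nat \<Rightarrow> nat"
  proof -
    have 1: "case_nat y (\<lambda>i. if i < m then h i else e (i - m))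
        = (\<lambda>i. if i < Suc m then case_nat y h i else e (i - Suc m))" for y h
      by (rule ext) (auto split: nat.split)
    have 2: "(\<lambda>i. if i < Suc m then h i else e (i - Suc m))
        = case_nat (h 0) (\<lambda>i. if i < m then h (Suc i) else e (i - m))" for h
      by (rule ext) (auto split: nat.split)
    show ?thesis
    proof
      assume "\<exists>h y. P (case_nat y (\<lambda>i. if i < m then h i else e (i - m)))"
      then show "\<exists>h. P (\<lambda>i. if i < Suc m then h i else e (i - Suc m))" unfolding 1 by blast
    next
      assume "\<exists>h. P (\<lambda>i. if i < Suc m then h i else e (i - Suc m))"
      then obtain h where "P (\<lambda>i. if i < Suc m then h i else e (i - Suc m))" ..
      then have "P (case_nat (h 0) (\<lambda>i. if i < m then h (Suc i) else e (i - m)))" unfolding 2 .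
      then show "\<exists>h y. P (case_nat y (\<lambda>i. if i < m then h i else e (i - m)))"
        by (intro exI[of _ "\<lambda>i. h (Suc i)"] exI[of _ "h 0"])
    qed
  qed
  then show ?case using * by simp
qed

text \<open>Unlike in \<open>re_ball\<close>, the number \<open>m\<close> is fixed and the
  predicates \<open>P j\<close> need not be uniform in \<open>j\<close>; this fits the list of
  components of a \<open>Cn\<close>.\<close>

lemma re_finite_conj:
  fixes m :: nat
  shows "(\<And>j. j < m \<Longrightarrow> re (P j)) \<Longrightarrow> re (\<lambda>e. \<forall>j<m. P j e)"
proof (induction m)
  case 0
  show ?case by (simp add: re_const)
next
  case (Suc m)
  then have "re (\<lambda>e. P m e \<and> (\<forall>j<m. P j e))" by (intro re_conj) auto
  then show ?case by (simp add: All_less_Suc)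
qed

text \<open>Primitive recursion is unrolled into the sequence of its intermediate values, the form
  treated by \<open>re_ex_seq\<close>.\<close>

lemma eval_Pr_iff_seq:
  "eval (Pr f g) (n # xs) r \<longleftrightarrow>
    (\<exists>h. eval f xs (h 0) \<and> (\<forall>i<n. eval g (i # h i # xs) (h (Suc i))) \<and> h n = r)"
proof (induction n arbitrary: r)
  case 0
  show ?case by (auto simp: eval_Pr_0_iff)
next
  case (Suc n)
  show ?case (is "_ \<longleftrightarrow> (\<exists>h. ?H h)")
  proof
    assume "eval (Pr f g) (Suc n # xs) r"
    then obtain q h where h: "eval f xs (h 0)" "\<forall>i<n. eval g (i # h i # xs) (h (Suc i))" "h n = q"
      "eval g (n # q # xs) r" unfolding eval_Pr_Suc_iff Suc.IH by blast
    then show "\<exists>h. ?H h" by (intro exI[of _ "h(Suc n := r)"]) (auto simp: less_Suc_eq)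
  next
    assume "\<exists>h. ?H h"
    then obtain h where h: "?H h" ..
    then have "eval (Pr f g) (n # xs) (h n)"
      unfolding Suc.IH by (intro exI[of _ h]) simp
    moreover have "eval g (n # h n # xs) r" using h by auto
    ultimately show "eval (Pr f g) (Suc n # xs) r" unfolding eval_Pr_Suc_iff by blast
  qed
qed

text \<open>A substitute for Kleene's normal form theorem, by induction on the program instead of
  through a universal machine.\<close>
lemma re_eval: "re (\<lambda>e. eval f (map (\<lambda>i. e (Suc i)) [0..<k]) (e 0))"
proof (induction f arbitrary: k)
  case Z
  show ?case by (simp add: eval_Z_iff re_rdec rdec_eq rfun_intros)
next
  case S
  show ?case
    by (cases k) (auto simp: eval_S_iff map_upt_Suc_conv re_const simp del: upt_Suc
        intro!: re_rdec rdec_eq rfun_intros)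
next
  case (Id i)
  show ?case
    by (cases "i < k") (auto simp: eval_Id_iff re_const intro!: re_rdec rdec_eq rfun_intros)
next
  case (Cn g fs)
  define m where "m = length fs"
  \<comment> \<open>The first \<open>m\<close> positions hold the intermediate results, position
    \<open>m\<close> the final result, and the arguments follow; \<open>re_ex_prefix\<close> then
    removes the first block.\<close>
  have f: "re (\<lambda>e. eval (fs ! j) (map (\<lambda>i. e (Suc (i + m))) [0..<k]) (e j))" if "j < m" for j
    using re_subst[OF Cn.IH(2)[of "fs ! j" k],
        of "\<lambda>l e. case_nat (e j) (\<lambda>i. e (Suc (i + m))) l"] that
    by (simp add: m_def rfun_case_nat rfun_var)
  have g: "re (\<lambda>e. eval g (map e [0..<m]) (e m))"
    using re_subst[OF Cn.IH(1)[of m], of "\<lambda>l e. case_nat (e m) (\<lambda>i. e i) l"]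
    by (simp add: rfun_case_nat rfun_var)
  have fs: "re (\<lambda>e. \<forall>j<m. eval (fs ! j) (map (\<lambda>i. e (Suc (i + m))) [0..<k]) (e j))"
    by (rule re_finite_conj) (rule f)
  have prefix: "map (\<lambda>i. if i < m then h i else h' i) [0..<m] = map h [0..<m]"
    for h h' :: "nat \<Rightarrow> nat" by simp
  from re_ex_prefix[OF re_conj[OF fs g], of m]
  have "re (\<lambda>e. \<exists>h. (\<forall>j<m. eval (fs ! j) (map (\<lambda>i. e (Suc i)) [0..<k]) (h j)) \<and>
      eval g (map h [0..<m]) (e 0))"
    by (simp add: prefix cong: conj_cong)
  moreover have "eval (Cn g fs) xs r \<longleftrightarrow>
      (\<exists>h. (\<forall>j<m. eval (fs ! j) xs (h j)) \<and> eval g (map h [0..<m]) r)" for xs r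
    unfolding eval_Cn_iff
    using list_all2_map_upt[of "\<lambda>f y. eval f xs y" "(!) fs" m] by (auto simp: m_def map_nth)
  ultimately show ?case by simp
next
  case (Pr f g)
  show ?case
  proof (cases k)
    case 0
    then show ?thesis by (simp add: not_eval_Pr_Nil re_const)
  next
    case (Suc l)
    have f: "re (\<lambda>e. eval f (map (\<lambda>i. e (Suc (Suc (Suc i)))) [0..<l]) (e 0))"
      using re_subst[OF Pr.IH(1)[of l], of "\<lambda>j e. case_nat (e 0) (\<lambda>i. e (Suc (Suc (Suc i)))) j"]
      by (simp add: rfun_case_nat rfun_var)
    \<comment> \<open>Positions 0 to 5 hold \<open>i\<close>, \<open>h i\<close>,
      \<open>h (Suc i)\<close>, the start value \<open>q\<close>, the result and the recursion
      argument.\<close>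
    have g: "re (\<lambda>e. eval g (e 0 # e (Suc 0) # map (\<lambda>i. e (Suc (Suc (Suc (Suc (Suc (Suc i))))))) [0..<l])
        (e (Suc (Suc 0))))"
      using re_subst[OF Pr.IH(2)[of "Suc (Suc l)"],
          of "\<lambda>j e. case_nat (e (Suc (Suc 0))) (\<lambda>j. case_nat (e 0) (\<lambda>j. case_nat (e (Suc 0))
            (\<lambda>i. e (Suc (Suc (Suc (Suc (Suc (Suc i))))))) j) j) j"]
      by (simp add: rfun_case_nat rfun_var map_upt_Suc_conv del: upt_Suc)
    \<comment> \<open>The start value gets its own name \<open>q\<close> because
      \<open>re_ex_seq\<close> wants \<open>h 0\<close> given by a computable function of the
      environment.\<close>
    have "re (\<lambda>e. \<exists>q. eval f (map (\<lambda>i. e (Suc (Suc i))) [0..<l]) q \<and>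
       (\<exists>h. h 0 = q \<and> (\<forall>i<e (Suc 0). eval g (i # h i # map (\<lambda>i. e (Suc (Suc i))) [0..<l]) (h (Suc i)))
          \<and> h (e (Suc 0)) = e 0))"
      by (rule re_ex, rule re_conj, rule f, rule re_ex_seq, rule g) (intro rfun_var)+
    moreover have "(\<exists>q. E q \<and> (\<exists>h. h 0 = q \<and> G h)) \<longleftrightarrow> (\<exists>h. E (h 0) \<and> G h)"
      for E :: "nat \<Rightarrow> bool" and G :: "(nat \<Rightarrow> nat) \<Rightarrow> bool" by blast
    ultimately show ?thesis
      by (simp add: Suc map_upt_Suc_conv eval_Pr_iff_seq del: upt_Suc cong: conj_cong)
  qed
next
  case (Mn f)
  have f: "re (\<lambda>e. eval f (X e # map (\<lambda>i. e (c + i)) [0..<k]) (Y e))"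
    if "rfun X" "rfun Y" for X Y c
    using re_subst[OF Mn.IH[of "Suc k"],
        of "\<lambda>j e. case_nat (Y e) (\<lambda>j. case_nat (X e) (\<lambda>i. e (c + i)) j) j"]
    by (simp add: rfun_case_nat rfun_var map_upt_Suc_conv that del: upt_Suc)
  \<comment> \<open>In the second predicate, positions 0, 1, 2 hold the nonzero value, the smaller
    candidate and the result, so the arguments start at 3.\<close>
  have "re (\<lambda>e. eval f (e 0 # map (\<lambda>i. e (1 + i)) [0..<k]) 0)"
    "re (\<lambda>e. eval f (e (Suc 0) # map (\<lambda>i. e (3 + i)) [0..<k]) (e 0))"
    by (intro f rfun_intros)+
  then show ?case
    unfolding eval_Mn_iff
    by (intro re_basic re_rdec[OF rdec_less] rfun_intros) (simp_all add: eval_nat_numeral)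
qed

text \<open>The program finds the least pair of witness and value with \<open>Mn\<close> and returns
  the value; single-valuedness ensures that the first value found is the right one.\<close>

lemma re_functional_eval:
  assumes R: "re (\<lambda>e. R (e 0) (e 1) (e 2))"
    and fn: "\<forall>p y z z'. R p y z \<longrightarrow> R p y z' \<longrightarrow> z = z'"
  shows "\<exists>f. \<forall>p y z. eval f [p, y] z = R p y z"
proof -
  obtain T where T: "rdec (\<lambda>e. T (e 0) (\<lambda>i. e (Suc i)))" "\<And>e. R (e 0) (e 1) (e 2) = (\<exists>s. T s e)"
    using R unfolding re_def by blast
  define t where "t w p y = T (pfst w) (case_nat p (case_nat y (\<lambda>_. psnd w)))" for w p y
  have RT: "R p y z \<longleftrightarrow> (\<exists>s. t (prod_encode (s, z)) p y)" for p y z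
    using T(2)[of "case_nat p (case_nat y (\<lambda>_. z))"] by (simp add: t_def numeral_2_eq_2)
  have "rdec (\<lambda>e. T (pfst (e 0)) (\<lambda>j. case_nat (e 1) (\<lambda>j. case_nat (e 2) (\<lambda>_. psnd (e 0)) j) j))"
    by (intro rdec_subst1[OF T(1)] rfun_case_nat rfun_intros)
  then have "rdec (\<lambda>e. t (e 0) (e 1) (e 2))" unfolding t_def .
  then obtain k f where f: "\<And>m e r. k \<le> m \<Longrightarrow>
      eval f (map e [0..<m]) r = (r = (if t (e 0) (e 1) (e 2) then 0 else 1))"
    unfolding rdec_def rfun_def by blast
  obtain l g where g: "\<And>m e r. l \<le> m \<Longrightarrow> eval g (map e [0..<m]) r = (r = psnd (e 0))"
    using rfun_psnd[OF rfun_var, of 0] unfolding rfun_def by blast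
  \<comment> \<open>The programs \<open>f\<close> and \<open>g\<close> are known to be correct only
    for long enough argument lists; \<open>pad\<close> supplies exactly \<open>n\<close> arguments,
    filling up with zeros.\<close>
  define pad where "pad h n m = Cn h (map (\<lambda>i. if i < m then Id i else Z) [0..<n])" for h and n m :: nat
  have pad: "eval (pad h n m) xs r \<longleftrightarrow> eval h (map (\<lambda>i. if i < m then xs ! i else 0) [0..<n]) r"
    if "length xs = m" for h n m xs r
  proof -
    have "eval (if i < m then Id i else Z) xs y \<longleftrightarrow> y = (if i < m then xs ! i else 0)" for i y
      using that by (simp add: eval_Id_iff eval_Z_iff)
    then show ?thesis unfolding pad_def by (intro eval_Cn_map)
  qed
  have f': "eval (pad f k 3) [w, p, y] r = (r = (if t w p y then 0 else 1))" for w p y r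
    by (simp add: pad f numeral_2_eq_2)
  have g': "eval (pad g l 1) [w] z = (z = psnd w)" for w z
    by (simp add: pad g)
  have "eval (Cn (pad g l 1) [Mn (pad f k 3)]) [p, y] z = R p y z" for p y z
  proof -
    have 1: "eval (Cn (pad g l 1) [Mn (pad f k 3)]) [p, y] z \<longleftrightarrow>
        (\<exists>w. t w p y \<and> (\<forall>v<w. \<not> t v p y) \<and> z = psnd w)"
    proof -
      have "eval (Cn (pad g l 1) [Mn (pad f k 3)]) [p, y] z \<longleftrightarrow>
          (\<exists>w. eval (Mn (pad f k 3)) [p, y] w \<and> eval (pad g l 1) [w] z)"
        unfolding eval_Cn_iff list_all2_Cons1 list_all2_Nil by blast
      moreover have "eval (Mn (pad f k 3)) [p, y] w \<longleftrightarrow> t w p y \<and> (\<forall>v<w. \<not> t v p y)" for w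
        unfolding eval_Mn_iff f' by auto
      ultimately show ?thesis unfolding g' by blast
    qed
    have tR: "t w p y \<Longrightarrow> R p y (psnd w)" for w
      unfolding RT by (metis encode_pfst_psnd)
    show ?thesis
    proof
      assume "R p y z"
      then have "\<exists>w. t w p y" unfolding RT by blast
      then obtain w where w: "t w p y" "\<And>v. v < w \<Longrightarrow> \<not> t v p y"
        using exists_least_iff[of "\<lambda>w. t w p y"] by blast
      then have "z = psnd w" using fn \<open>R p y z\<close> tR by blast
      with w show "eval (Cn (pad g l 1) [Mn (pad f k 3)]) [p, y] z"
        unfolding 1 by blast
    next
      assume "eval (Cn (pad g l 1) [Mn (pad f k 3)]) [p, y] z"
      then show "R p y z" unfolding 1 using tR by blast
    qed
  qed
  then show ?thesis by blast
qed

section \<open>Codes of bit strings\<close>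

text \<open>This is bijective binary notation with digits 1 and 2, lowest first; parity reveals the
  first digit.\<close>

lemma inj_nat_of_bits: "nat_of_bits xs = nat_of_bits ys \<Longrightarrow> xs = ys"
proof (induction xs arbitrary: ys)
  case Nil
  then show ?case by (cases ys) (auto split: if_splits)
next
  case (Cons x xs)
  then obtain y ys' where ys: "ys = y # ys'" by (cases ys) (auto split: if_splits)
  have "x = y \<and> nat_of_bits xs = nat_of_bits ys'"
    using Cons.prems ys by (cases x; cases y) (simp_all, presburger+)
  then show ?case using ys Cons.IH by auto
qed

lemma surj_nat_of_bits: "\<exists>xs. nat_of_bits xs = n"
proof (induction n rule: less_induct)
  case (less n)
  show ?case
  proof (cases "n = 0")
    case True
    then show ?thesis by (intro exI[of _ "[]"]) simp
  next
    case False
    then obtain xs where "nat_of_bits xs = (n - 1) div 2" using less[of "(n - 1) div 2"] by force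
    then have "nat_of_bits (even n # xs) = n" using False by simp presburger
    then show ?thesis ..
  qed
qed

definition bits_of_nat :: "nat \<Rightarrow> bool list" where "bits_of_nat = inv nat_of_bits"

lemma bits_of_nat_of_bits [simp]: "bits_of_nat (nat_of_bits xs) = xs"
  unfolding bits_of_nat_def by (rule inv_f_f) (auto intro: injI inj_nat_of_bits)

lemma nat_of_bits_of_nat [simp]: "nat_of_bits (bits_of_nat n) = n"
  using surj_nat_of_bits[of n] by auto

lemma bits_of_nat_inject [simp]: "bits_of_nat m = bits_of_nat n \<longleftrightarrow> m = n"
  by (metis nat_of_bits_of_nat)

lemma bits_of_nat_simps:
  "bits_of_nat 0 = []"
  "bits_of_nat (2 * n + 1) = False # bits_of_nat n"
  "bits_of_nat (2 * n + 2) = True # bits_of_nat n"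
  by (rule inj_nat_of_bits, simp)+

text \<open>This is the integer part of the binary logarithm of \<open>n + 1\<close>.\<close>

definition len :: "nat \<Rightarrow> nat" where "len n = length (bits_of_nat n)"

lemma len_simps: "len 0 = 0" "len (2 * n + 1) = Suc (len n)" "len (2 * n + 2) = Suc (len n)"
  unfolding len_def bits_of_nat_simps by simp_all

lemma len_bounds: "2 ^ len n \<le> Suc n" "Suc n < 2 ^ Suc (len n)"
proof -
  have "2 ^ length xs \<le> Suc (nat_of_bits xs) \<and> Suc (nat_of_bits xs) < 2 ^ Suc (length xs)" for xs
    by (induction xs) auto
  from this[of "bits_of_nat n"] show "2 ^ len n \<le> Suc n" "Suc n < 2 ^ Suc (len n)"
    by (simp_all add: len_def)
qed

text \<open>There are \<open>2 ^ t - 1\<close> strings shorter than \<open>t\<close>, and they have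
  the smallest codes. Being a short program is thus an arithmetic bound.\<close>

lemma len_less_iff: "len n < t \<longleftrightarrow> Suc n < 2 ^ t"
proof
  assume "len n < t"
  then have "(2::nat) ^ Suc (len n) \<le> 2 ^ t" by (intro power_increasing) auto
  then show "Suc n < 2 ^ t" using len_bounds(2)[of n] by linarith
next
  assume "Suc n < 2 ^ t"
  then have "(2::nat) ^ len n < 2 ^ t" using len_bounds(1)[of n] by linarith
  then show "len n < t" by simp
qed

lemma len_mono: "m \<le> n \<Longrightarrow> len m \<le> len n"
  using len_less_iff[of n "len m"] len_less_iff[of m "len m"] by linarith

lemma len_le_log: "real (len n) \<le> log 2 (real n + 1)"
proof -
  have "real (2 ^ len n) \<le> real (Suc n)" using len_bounds(1) of_nat_le_iff by blast
  then show ?thesis by (simp add: le_log_iff powr_realpow add.commute)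
qed

section \<open>The pair encoding as a computable function on codes\<close>

definition npair :: "nat \<Rightarrow> nat \<Rightarrow> nat" where
  "npair v w = nat_of_bits (pair_str (bits_of_nat v) (bits_of_nat w))"

lemma bits_of_nat_npair [simp]:
  "bits_of_nat (npair v w) = pair_str (bits_of_nat v) (bits_of_nat w)"
  by (simp add: npair_def)

text \<open>Prepending two bits maps a code \<open>m\<close> to \<open>4 * m\<close> plus a
  constant: 5 for the separator 01, 3 for 00 and 6 for 11.\<close>

lemma npair_simps:
  "npair 0 w = 4 * w + 5"
  "npair (2 * v + 1) w = 4 * npair v w + 3"
  "npair (2 * v + 2) w = 4 * npair v w + 6"
  unfolding npair_def bits_of_nat_simps by (simp_all add: pair_str_def)

lemma pair_str_inject: "pair_str v w = pair_str v' w' \<longleftrightarrow> v = v' \<and> w = w'"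
proof (induction v arbitrary: v')
  case Nil
  show ?case by (cases v') (auto simp: pair_str_def)
next
  case (Cons x v)
  show ?case
    using Cons.IH[of "tl v'"] by (cases v') (auto simp: pair_str_def)
qed

lemma npair_inject [simp]: "npair v w = npair v' w' \<longleftrightarrow> v = v' \<and> w = w'"
  using pair_str_inject[of "bits_of_nat v" "bits_of_nat w" "bits_of_nat v'" "bits_of_nat w'"]
    bits_of_nat_inject[of "npair v w" "npair v' w'"] by simp

lemma len_npair: "len (npair v w) = 2 * len v + 2 + len w"
proof -
  have "length (pair_str xs ys) = 2 * length xs + 2 + length ys" for xs ys
    by (induction xs) (auto simp: pair_str_def)
  then show ?thesis by (simp add: len_def)
qed

lemma nat_bits_cases:
  obtains "n = 0" | m where "n = 2 * m + 1" | m where "n = 2 * m + (2::nat)"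
proof -
  have "n = 0 \<or> n = 2 * ((n - 1) div 2) + 1 \<or> n = 2 * ((n - 1) div 2) + 2" by presburger
  then show thesis using that by blast
qed

text \<open>The recursion runs over the bits of the first component. It is expressed as reachability
  under prepending a bit, so the graph is enumerable and \<open>re_rfun\<close> applies.\<close>

lemma rfun_npair:
  assumes "rfun A" "rfun B"
  shows "rfun (\<lambda>e. npair (A e) (B e))"
proof (rule re_rfun)
  define R where "R s s' \<longleftrightarrow> s' = prod_encode (2 * pfst s + 1, 4 * psnd s + 3) \<or>
      s' = prod_encode (2 * pfst s + 2, 4 * psnd s + 6)" for s s'
  have *: "npair v w = r \<longleftrightarrow> R\<^sup>*\<^sup>* (prod_encode (0, 4 * w + 5)) (prod_encode (v, r))" for v w r
  proof
    have "R\<^sup>*\<^sup>* (prod_encode (0, 4 * w + 5)) (prod_encode (v, npair v w))"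
    proof (induction v rule: less_induct)
      case (less v)
      show ?case
      proof (cases v rule: nat_bits_cases)
        case 1
        then show ?thesis by (simp add: npair_simps)
      next
        case (2 m)
        have "R (prod_encode (m, npair m w)) (prod_encode (v, npair v w))"
          unfolding R_def 2 npair_simps by simp
        with less[of m] 2 show ?thesis by (auto intro: rtranclp.rtrancl_into_rtrancl)
      next
        case (3 m)
        have "R (prod_encode (m, npair m w)) (prod_encode (v, npair v w))"
          unfolding R_def 3 npair_simps by simp
        with less[of m] 3 show ?thesis by (auto intro: rtranclp.rtrancl_into_rtrancl)
      qed
    qed
    then show "npair v w = r \<Longrightarrow> R\<^sup>*\<^sup>* (prod_encode (0, 4 * w + 5)) (prod_encode (v, r))" by blast
  next
    assume "R\<^sup>*\<^sup>* (prod_encode (0, 4 * w + 5)) (prod_encode (v, r))"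
    then have "psnd (prod_encode (v, r)) = npair (pfst (prod_encode (v, r))) w"
    proof (induction rule: rtranclp_induct)
      case base
      show ?case by (simp add: npair_simps)
    next
      case (step s s')
      then show ?case unfolding R_def
        by (elim disjE) (simp_all only: pfst_encode psnd_encode npair_simps)
    qed
    then show "npair v w = r" by simp
  qed
  have "rdec (\<lambda>e. R (e 0) (e (Suc 0)))"
    unfolding R_def by (intro rdec_basic rfun_intros)
  then show "re (\<lambda>e. npair (A (\<lambda>i. e (Suc i))) (B (\<lambda>i. e (Suc i))) = e 0)"
    unfolding * by (intro re_rtranclp re_rdec rfun_intros rfun_shift assms)
qed

section \<open>Computable description modes as single-valued enumerable relations\<close>

lemma computable_mode_imp_re:
  assumes "computable_mode D"
  shows "re (\<lambda>e. D (bits_of_nat (e 0)) (bits_of_nat (e 1)) = Some (bits_of_nat (e 2)))"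
proof -
  obtain f where f: "\<And>p y z. eval f [nat_of_bits p, nat_of_bits y] (nat_of_bits z) = (D p y = Some z)"
    using assms unfolding computable_mode_def by blast
  have "re (\<lambda>e. eval f [e 0, e 1] (e 2))"
    using re_subst[OF re_eval[of f 2], of "\<lambda>j e. case_nat (e 2) (\<lambda>i. e i) j"]
    by (simp add: rfun_case_nat rfun_var eval_nat_numeral)
  moreover have "eval f [p, y] z \<longleftrightarrow> D (bits_of_nat p) (bits_of_nat y) = Some (bits_of_nat z)" for p y z
    using f[of "bits_of_nat p" "bits_of_nat y" "bits_of_nat z"] by simp
  ultimately show ?thesis by simp
qed

lemma re_imp_computable_mode:
  assumes R: "re (\<lambda>e. R (e 0) (e 1) (e 2))"
    and fn: "\<forall>p y z z'. R p y z \<longrightarrow> R p y z' \<longrightarrow> z = z'"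
  shows "\<exists>D. computable_mode D \<and>
    (\<forall>p y z. D (bits_of_nat p) (bits_of_nat y) = Some (bits_of_nat z) \<longleftrightarrow> R p y z)"
proof -
  define D where "D p y = (if \<exists>z. R (nat_of_bits p) (nat_of_bits y) z
    then Some (bits_of_nat (THE z. R (nat_of_bits p) (nat_of_bits y) z)) else None)" for p y
  have D: "D p y = Some z \<longleftrightarrow> R (nat_of_bits p) (nat_of_bits y) (nat_of_bits z)" for p y z
  proof (cases "\<exists>z. R (nat_of_bits p) (nat_of_bits y) z")
    case True
    then obtain w where w: "R (nat_of_bits p) (nat_of_bits y) w" ..
    then have "(THE z. R (nat_of_bits p) (nat_of_bits y) z) = w" using fn by blast
    then have "D p y = Some (bits_of_nat w)" using w unfolding D_def by auto
    then show ?thesis using w fn by (metis bits_of_nat_of_bits nat_of_bits_of_nat option.inject)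
  qed (auto simp: D_def)
  obtain f where "\<And>p y z. eval f [p, y] z = R p y z"
    using re_functional_eval[OF R fn] by blast
  then have "computable_mode D" unfolding computable_mode_def D by blast
  then show ?thesis using D by (intro exI[of _ D]) simp
qed

section \<open>Complexity bounds for tables\<close>

text \<open>The code \<open>F\<close> carries the base together with the digits, so a table can be
  read without knowing \<open>N\<close>.\<close>

definition look :: "nat \<Rightarrow> nat \<Rightarrow> nat" where "look F x = dig (pfst F) (psnd F) x"

lemma rfun_look: "rfun A \<Longrightarrow> rfun B \<Longrightarrow> rfun (\<lambda>e. look (A e) (B e))"
  unfolding look_def by (intro rfun_intros)

locale optimal =
  fixes D :: "bool list \<Rightarrow> bool list \<Rightarrow> bool list option"
  assumes optimal: "optimal_mode D"
begin

definition U :: "nat \<Rightarrow> nat \<Rightarrow> nat \<Rightarrow> bool" where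
  "U p y z \<longleftrightarrow> D (bits_of_nat p) (bits_of_nat y) = Some (bits_of_nat z)"

definition K :: "nat \<Rightarrow> nat \<Rightarrow> nat" where
  "K x y = KS D (bits_of_nat x) (bits_of_nat y)"

lemma re_U: "rfun A \<Longrightarrow> rfun B \<Longrightarrow> rfun C \<Longrightarrow> re (\<lambda>e. U (A e) (B e) (C e))"
  unfolding U_def
  using re_3[OF computable_mode_imp_re[OF conjunct1[OF optimal[unfolded optimal_mode_def]]]] .

lemma U_functional: "U p y z \<Longrightarrow> U p y z' \<Longrightarrow> z = z'"
  by (simp add: U_def)

text \<open>Any enumerable single-valued \<open>R\<close> is a description mode, so upper bounds on
  complexity only require an \<open>R\<close> that decodes the intended descriptions.\<close>

lemma simulate:
  assumes R: "re (\<lambda>e. R (e 0) (e 1) (e 2))"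
    and fn: "\<forall>p y z z'. R p y z \<longrightarrow> R p y z' \<longrightarrow> z = z'"
  shows "\<exists>c. \<forall>p y z. R p y z \<longrightarrow> (\<exists>q. U q y z \<and> len q \<le> len p + c)"
proof -
  obtain D' where D': "computable_mode D'"
    "\<And>p y z. D' (bits_of_nat p) (bits_of_nat y) = Some (bits_of_nat z) \<longleftrightarrow> R p y z"
    using re_imp_computable_mode[OF R fn] by blast
  then obtain c where c: "\<And>p y x. D' p y = Some x \<Longrightarrow> \<exists>q. D q y = Some x \<and> length q \<le> length p + c"
    using optimal unfolding optimal_mode_def by blast
  have "\<exists>q. U q y z \<and> len q \<le> len p + c" if "R p y z" for p y z
  proof -
    have "D' (bits_of_nat p) (bits_of_nat y) = Some (bits_of_nat z)" using that by (simp add: D'(2))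
    from c[OF this] obtain q where "D q (bits_of_nat y) = Some (bits_of_nat z)" "length q \<le> len p + c"
      unfolding len_def by blast
    then show ?thesis unfolding U_def len_def by (intro exI[of _ "nat_of_bits q"]) simp
  qed
  then show ?thesis by blast
qed

lemma K_le: "U p y z \<Longrightarrow> K z y \<le> len p"
  unfolding U_def K_def KS_def len_def by (rule Least_le, intro exI[of _ "bits_of_nat p"]) simp

lemma K_le_simulate:
  assumes "re (\<lambda>e. R (e 0) (e 1) (e 2))"
    and "\<forall>p y z z'. R p y z \<longrightarrow> R p y z' \<longrightarrow> z = z'"
  shows "\<exists>c. \<forall>p y z. R p y z \<longrightarrow> K z y \<le> len p + c"
proof -
  obtain c where c: "\<And>p y z. R p y z \<Longrightarrow> \<exists>q. U q y z \<and> len q \<le> len p + c"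
    using simulate[OF assms] by blast
  have "K z y \<le> len p + c" if R: "R p y z" for p y z
  proof -
    obtain q where "U q y z" "len q \<le> len p + c" using c[OF R] by blast
    then show ?thesis using K_le[of q y z] by simp
  qed
  then show ?thesis by blast
qed

lemma K_le_len: "\<exists>c. \<forall>z y. K z y \<le> len z + c"
proof -
  have "\<exists>c. \<forall>p y z. z = p \<longrightarrow> K z y \<le> len p + c"
    by (rule K_le_simulate) (intro re_rdec[OF rdec_eq] rfun_var, blast)
  then show ?thesis by blast
qed

text \<open>The \<open>LEAST\<close> in \<open>KS\<close> is meaningful because simulating the
  identity mode provides at least one program.\<close>

lemma K_attained: "\<exists>p. U p y z \<and> len p = K z y"
proof -
  obtain q where "U q y z"
    using simulate[of "\<lambda>p y z. z = p"] re_rdec[OF rdec_eq[OF rfun_var rfun_var]] by blast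
  then have "\<exists>n p. length p = n \<and> D p (bits_of_nat y) = Some (bits_of_nat z)" unfolding U_def by blast
  from LeastI_ex[OF this] obtain p
    where "length p = K z y" "D p (bits_of_nat y) = Some (bits_of_nat z)"
    unfolding K_def KS_def by blast
  then show ?thesis unfolding U_def len_def by (intro exI[of _ "nat_of_bits p"]) simp
qed

lemma K_look_arg: "\<exists>c. \<forall>a f. K (look f a) (npair a f) \<le> c"
proof -
  have "re (\<lambda>e. \<exists>a f. e 1 = npair a f \<and> e 2 = look f a)"
    by (intro re_ex re_rdec rdec_basic rfun_intros rfun_npair rfun_look)
  from K_le_simulate[of "\<lambda>p y z. \<exists>a f. y = npair a f \<and> z = look f a", OF this]
  obtain c where "\<forall>p y z. (\<exists>a f. y = npair a f \<and> z = look f a) \<longrightarrow> K z y \<le> len p + c"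
    by fastforce
  \<comment> \<open>The condition alone determines the output, so the empty program, with code 0,
    suffices.\<close>
  then have "K (look f a) (npair a f) \<le> len 0 + c" for a f by blast
  then show ?thesis unfolding len_simps by (intro exI[of _ c]) simp
qed

text \<open>A single mode serves both bounds: the first bit of the program tells whether the output
  for \<open>c\<close> is final or is to be looked up in \<open>f\<close>. That bit is the reason
  for \<open>Suc k\<close> in the proof.\<close>

lemma K_look_cond:
  "\<exists>k. \<forall>a b c f. K b (npair c f) \<le> K b c + k \<and> K (look f a) (npair c f) \<le> K a c + k"
proof -
  define R where "R p y z \<longleftrightarrow> (\<exists>c f q. y = npair c f \<and> (p = 2 * q + 1 \<and> U q c z \<or>
      p = 2 * q + 2 \<and> (\<exists>v. U q c v \<and> z = look f v)))" for p y z
  have "re (\<lambda>e. R (e 0) (e 1) (e 2))"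
    unfolding R_def
    by (intro re_basic re_rdec[OF rdec_eq] re_U rfun_intros rfun_npair rfun_look)
  moreover have "z = z'" if R: "R p y z" "R p y z'" for p y z z'
  proof -
    have odd: "2 * q + 1 = 2 * q' + 1 \<longleftrightarrow> q = q'" "2 * q + 2 = 2 * q' + 2 \<longleftrightarrow> q = q'"
      "2 * q + 1 \<noteq> 2 * q' + 2" for q q' :: nat by presburger+
    from R show ?thesis unfolding R_def using U_functional odd
      by (metis npair_inject)
  qed
  ultimately obtain k where k: "\<And>p y z. R p y z \<Longrightarrow> K z y \<le> len p + k"
    using K_le_simulate[of R] by metis
  have "K b (npair c f) \<le> K b c + Suc k" for b c f
  proof -
    obtain q where q: "U q c b" "len q = K b c" using K_attained by blast
    then have "R (2 * q + 1) (npair c f) b" unfolding R_def by blast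
    from k[OF this] show ?thesis unfolding len_simps using q by simp
  qed
  moreover have "K (look f a) (npair c f) \<le> K a c + Suc k" for a c f
  proof -
    obtain q where q: "U q c a" "len q = K a c" using K_attained by blast
    then have "R (2 * q + 2) (npair c f) (look f a)" unfolding R_def by blast
    from k[OF this] show ?thesis unfolding len_simps using q by simp
  qed
  ultimately show ?thesis by blast
qed

section \<open>Bad pairs and the size of their matchings\<close>

definition bad :: "nat \<Rightarrow> nat \<Rightarrow> nat \<Rightarrow> nat \<Rightarrow> nat \<Rightarrow> bool" where
  "bad n t c a b \<longleftrightarrow> a < n \<and> b < n \<and>
    (\<forall>u < n ^ n. dig n u a \<noteq> b \<or> (\<exists>p. Suc p < 2 ^ t \<and> U p (npair c (prod_encode (n, u))) b))"

text \<open>The universal quantifier ranges over finitely many tables \<open>u < n ^ n\<close>, and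
  for each of them the existence of a short program is enumerable.\<close>

lemma re_bad:
  assumes "rfun N" "rfun T" "rfun C" "rfun A" "rfun B"
  shows "re (\<lambda>e. bad (N e) (T e) (C e) (A e) (B e))"
  unfolding bad_def
  by (intro re_basic re_rdec[OF rdec_less] re_rdec[OF rdec_not] rdec_eq re_U
      rfun_intros rfun_npair rfun_shift assms)

text \<open>A single table contains the whole matching, so all of its values are simple given that table.\<close>
lemma card_bad_matching:
  assumes g: "inj_on g A" and fin: "finite A" and bad: "\<And>x. x \<in> A \<Longrightarrow> bad n t c x (g x)"
  shows "card A < 2 ^ t"
proof (cases "A = {}")
  case False
  then have n: "0 < n" using bad unfolding bad_def by fastforce
  \<comment> \<open>Off the matching the table takes the default value 0, which is a legal digit
    since \<open>n\<close> is positive.\<close>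
  have "(if i \<in> A then g i else 0) < n" for i using bad n unfolding bad_def by auto
  from ex_dig[of n "\<lambda>i. if i \<in> A then g i else 0", OF this]
  obtain u where u: "u < n ^ n" "\<And>i. i < n \<Longrightarrow> dig n u i = (if i \<in> A then g i else 0)" by auto
  have "\<exists>p. Suc p < 2 ^ t \<and> U p (npair c (prod_encode (n, u))) (g x)" if "x \<in> A" for x
    using bad[OF that] u that unfolding bad_def by auto
  then obtain P where P: "\<And>x. x \<in> A \<Longrightarrow> Suc (P x) < 2 ^ t"
    "\<And>x. x \<in> A \<Longrightarrow> U (P x) (npair c (prod_encode (n, u))) (g x)" by metis
  \<comment> \<open>Under the same condition, distinct values \<open>g x\<close> need distinct
    programs, and fewer than \<open>2 ^ t\<close> are short enough.\<close>
  have "inj_on P A" using P(2) U_functional g unfolding inj_on_def by metis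
  moreover have "P ` A \<subseteq> {..<2 ^ t - 1}" using P(1) by fastforce
  ultimately have "card A \<le> 2 ^ t - 1" using card_inj_on_le[of P A "{..<2 ^ t - 1}"] by simp
  moreover have "(0::nat) < 2 ^ t" by simp
  ultimately show ?thesis by linarith
qed simp

section \<open>Enumerable greedy construction of a maximal matching\<close>

definition fresh_bad :: "nat \<Rightarrow> nat \<Rightarrow> bool" where
  "fresh_bad y x \<longleftrightarrow>
    pfst (psnd x) div 2 ^ pfst y mod 2 = 0 \<and> psnd (psnd x) div 2 ^ psnd y mod 2 = 0 \<and>
    bad (2 ^ Suc (pfst (pfst x))) (pfst (psnd (pfst x))) (psnd (psnd (pfst x))) (pfst y) (psnd y)"

definition state :: "nat \<Rightarrow> nat \<Rightarrow> nat \<Rightarrow> nat \<Rightarrow> nat \<Rightarrow> nat" where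
  "state N t c A B = prod_encode (prod_encode (N, prod_encode (t, c)), prod_encode (A, B))"

text \<open>The tests modulo 2 read single bits of the masks, which is membership in
  \<open>set_decode\<close>; the arithmetic form makes them decidable.\<close>

lemma fresh_bad_state:
  "fresh_bad (prod_encode (a, b)) (state N t c A B) \<longleftrightarrow>
    a \<notin> set_decode A \<and> b \<notin> set_decode B \<and> bad (2 ^ Suc N) t c a b"
  by (simp add: fresh_bad_def state_def set_decode_def even_iff_mod_2_eq_zero)

lemma re_fresh_bad: "re (\<lambda>e. fresh_bad (e 0) (e 1))"
  unfolding fresh_bad_def by (intro re_conj re_rdec[OF rdec_eq] re_bad rfun_intros)

text \<open>Fresh bad pairs are merely enumerable, so a choice such as the numerically least one
  need not be effective; \<open>re_uniformize\<close> provides an enumerable choice, and one is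
  fixed here.\<close>

definition pick :: "nat \<Rightarrow> nat \<Rightarrow> bool" where
  "pick = (SOME Q. re (\<lambda>e. Q (e 0) (e 1)) \<and> (\<forall>y x. Q y x \<longrightarrow> fresh_bad y x) \<and>
    (\<forall>y z x. Q y x \<longrightarrow> Q z x \<longrightarrow> y = z) \<and> (\<forall>y x. fresh_bad y x \<longrightarrow> (\<exists>z. Q z x)))"

lemma pick_spec:
  "re (\<lambda>e. pick (e 0) (e 1)) \<and> (\<forall>y x. pick y x \<longrightarrow> fresh_bad y x) \<and>
    (\<forall>y z x. pick y x \<longrightarrow> pick z x \<longrightarrow> y = z) \<and> (\<forall>y x. fresh_bad y x \<longrightarrow> (\<exists>z. pick z x))"
  using someI_ex[OF re_uniformize[OF re_fresh_bad]] unfolding pick_def[symmetric] .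

lemmas re_pick = re_2[OF conjunct1[OF pick_spec]]
  and pick_fresh = pick_spec[THEN conjunct2, THEN conjunct1, rule_format]
  and pick_functional = pick_spec[THEN conjunct2, THEN conjunct2, THEN conjunct1, rule_format]
  and pick_total = pick_spec[THEN conjunct2, THEN conjunct2, THEN conjunct2, rule_format]

text \<open>Greedy construction of a maximal matching: a configuration consists of the number of pairs
  chosen so far and of the two sets of their components, as bit masks.\<close>
definition chosen :: "nat \<Rightarrow> nat \<Rightarrow> nat \<Rightarrow> nat \<Rightarrow> nat \<Rightarrow> bool" where
  "chosen N t c s y \<longleftrightarrow> pick y (state N t c (pfst (psnd s)) (psnd (psnd s)))"

definition step :: "nat \<Rightarrow> nat \<Rightarrow> nat \<Rightarrow> nat \<Rightarrow> nat \<Rightarrow> bool" where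
  "step N t c s s' \<longleftrightarrow> (\<exists>y. chosen N t c s y \<and> s' = prod_encode (Suc (pfst s),
    prod_encode (2 ^ pfst y + pfst (psnd s), 2 ^ psnd y + psnd (psnd s))))"

definition reach :: "nat \<Rightarrow> nat \<Rightarrow> nat \<Rightarrow> nat \<Rightarrow> bool" where
  "reach N t c s \<longleftrightarrow> (step N t c)\<^sup>*\<^sup>* (prod_encode (0, prod_encode (0, 0))) s"

text \<open>This is the decompressor for components of the matching: the program holds
  \<open>t\<close>, \<open>N\<close>, the number of pairs chosen earlier, and one bit that selects
  the component.\<close>

definition greedy :: "nat \<Rightarrow> nat \<Rightarrow> nat \<Rightarrow> bool" where
  "greedy p c z \<longleftrightarrow> (\<exists>t N s y. reach N t c s \<and> chosen N t c s y \<and>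
    (p = npair t (npair N (2 * pfst s + 1)) \<and> z = pfst y \<or>
     p = npair t (npair N (2 * pfst s + 2)) \<and> z = psnd y))"

lemma re_chosen:
  assumes "rfun N" "rfun T" "rfun C" "rfun V" "rfun Y"
  shows "re (\<lambda>e. chosen (N e) (T e) (C e) (V e) (Y e))"
  unfolding chosen_def state_def by (intro re_pick rfun_intros assms)

lemma re_reach:
  assumes "rfun N" "rfun T" "rfun C" "rfun V"
  shows "re (\<lambda>e. reach (N e) (T e) (C e) (V e))"
proof -
  have "re (\<lambda>e. step (N (\<lambda>i. e (Suc (Suc i)))) (T (\<lambda>i. e (Suc (Suc i)))) (C (\<lambda>i. e (Suc (Suc i))))
      (e 0) (e (Suc 0)))"
    unfolding step_def
    by (intro re_basic re_chosen re_rdec[OF rdec_eq] rfun_intros rfun_shift assms)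
  from re_rtranclp[of "\<lambda>x y e. step (N e) (T e) (C e) x y", OF this, OF rfun_const assms(4)]
  show ?thesis unfolding reach_def by simp
qed

lemma re_greedy: "re (\<lambda>e. greedy (e 0) (e 1) (e 2))"
  unfolding greedy_def
  by (intro re_basic re_reach re_chosen re_rdec[OF rdec_eq] rfun_intros rfun_npair)

text \<open>Every step is deterministic and raises the counter by one, so the counter determines the
  whole run.\<close>

lemma reach_unique:
  assumes "reach N t c s" "reach N t c s'" "pfst s = pfst s'"
  shows "s = s'"
  using assms
proof (induction "pfst s" arbitrary: s s')
  case 0
  then show ?case unfolding reach_def
    by (auto elim!: rtranclp.cases[of "step N t c" _ s] rtranclp.cases[of "step N t c" _ s'] simp: step_def)
next
  case (Suc n)
  have pred: "\<exists>r. reach N t c r \<and> step N t c r s \<and> pfst r = n" if "reach N t c s" "pfst s = Suc n" for s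
    using that unfolding reach_def
    by (cases rule: rtranclp.cases) (auto simp: step_def)
  obtain r where r: "reach N t c r" "step N t c r s" "pfst r = n" using pred Suc.prems Suc.hyps by metis
  obtain r' where r': "reach N t c r'" "step N t c r' s'" "pfst r' = n"
    using pred Suc.prems Suc.hyps by metis
  have "r = r'" using Suc.hyps(1) r r' by metis
  then show ?case using r(2) r'(2) pick_functional unfolding step_def chosen_def by metis
qed

text \<open>A program parses in only one way, by injectivity of \<open>npair\<close> and by parity;
  the counter then fixes the configuration, and \<open>pick\<close> the next pair.\<close>

lemma greedy_functional: "greedy p c z \<Longrightarrow> greedy p c z' \<Longrightarrow> z = z'"
proof -
  assume z: "greedy p c z" and z': "greedy p c z'"
  have odd: "2 * q + 1 = 2 * q' + 1 \<longleftrightarrow> q = q'" "2 * q + 2 = 2 * q' + 2 \<longleftrightarrow> q = q'"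
    "2 * q + 1 \<noteq> 2 * q' + 2" "2 * q' + 2 \<noteq> 2 * q + 1" for q q' :: nat by presburger+
  obtain t N s y where 1: "reach N t c s" "chosen N t c s y"
    "p = npair t (npair N (2 * pfst s + 1)) \<and> z = pfst y \<or>
     p = npair t (npair N (2 * pfst s + 2)) \<and> z = psnd y"
    using z unfolding greedy_def by blast
  obtain t' N' s' y' where 2: "reach N' t' c s'" "chosen N' t' c s' y'"
    "p = npair t' (npair N' (2 * pfst s' + 1)) \<and> z' = pfst y' \<or>
     p = npair t' (npair N' (2 * pfst s' + 2)) \<and> z' = psnd y'"
    using z' unfolding greedy_def by blast
  have eq: "t' = t" "N' = N" "pfst s' = pfst s"
    using 1(3) 2(3) odd(3,4) by (elim disjE conjE; simp)+
  then have "s' = s" using 1(1) 2(1) reach_unique by blast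
  then have "y' = y" using 1(2) 2(2) eq pick_functional unfolding chosen_def by blast
  then show ?thesis using 1(3) 2(3) odd(3,4) by (elim disjE conjE) simp_all
qed

text \<open>The masks are the two sides of a matching \<open>g\<close> of bad pairs, which bounds
  the counter through \<open>card_bad_matching\<close>; the last two conjuncts give each matched
  component a short description.\<close>

lemma reach_invariant:
  assumes "reach N t c s"
  shows "\<exists>g. inj_on g (set_decode (pfst (psnd s))) \<and>
    g ` set_decode (pfst (psnd s)) = set_decode (psnd (psnd s)) \<and>
    card (set_decode (pfst (psnd s))) = pfst s \<and>
    (\<forall>x \<in> set_decode (pfst (psnd s)). bad (2 ^ Suc N) t c x (g x)) \<and>
    (\<forall>x \<in> set_decode (pfst (psnd s)). \<exists>i<pfst s. greedy (npair t (npair N (2 * i + 1))) c x) \<and>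
    (\<forall>x \<in> set_decode (psnd (psnd s)). \<exists>i<pfst s. greedy (npair t (npair N (2 * i + 2))) c x)"
  using assms unfolding reach_def
proof (induction rule: rtranclp_induct)
  case base
  show ?case by simp
next
  case (step s s')
  define A B where "A = set_decode (pfst (psnd s))" and "B = set_decode (psnd (psnd s))"
  obtain g where g: "inj_on g A" "g ` A = B" "card A = pfst s" "\<forall>x\<in>A. bad (2 ^ Suc N) t c x (g x)"
    "\<forall>x\<in>A. \<exists>i<pfst s. greedy (npair t (npair N (2 * i + 1))) c x"
    "\<forall>x\<in>B. \<exists>i<pfst s. greedy (npair t (npair N (2 * i + 2))) c x"
    using step.IH unfolding A_def B_def by blast
  obtain y where y: "chosen N t c s y" and s': "s' = prod_encode (Suc (pfst s),
    prod_encode (2 ^ pfst y + pfst (psnd s), 2 ^ psnd y + psnd (psnd s)))"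
    using step.hyps(2) unfolding step_def by blast
  have f: "pfst y \<notin> A" "psnd y \<notin> B" "bad (2 ^ Suc N) t c (pfst y) (psnd y)"
    using pick_fresh[OF y[unfolded chosen_def]] fresh_bad_state[of "pfst y" "psnd y"]
    unfolding A_def B_def by auto
  \<comment> \<open>Adding a power of two inserts an element only if that bit was clear, which
    freshness guarantees.\<close>
  have A': "set_decode (pfst (psnd s')) = insert (pfst y) A"
    and B': "set_decode (psnd (psnd s')) = insert (psnd y) B"
    using f unfolding s' A_def B_def by (auto simp: set_decode_plus_power_2)
  have j: "pfst s' = Suc (pfst s)" by (simp add: s')
  have "finite A" by (simp add: A_def)
  have gr: "greedy (npair t (npair N (2 * pfst s + 1))) c (pfst y)"
    "greedy (npair t (npair N (2 * pfst s + 2))) c (psnd y)"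
    using step.hyps(1) y unfolding greedy_def reach_def by blast+
  define g' where "g' = g(pfst y := psnd y)"
  have g'A: "x \<in> A \<Longrightarrow> g' x = g x" for x using f(1) by (auto simp: g'_def)
  have g'y: "g' (pfst y) = psnd y" by (simp add: g'_def)
  have img: "g' ` A = B" using g(2) g'A by force
  show ?case unfolding A' B' j
  proof (intro exI[of _ g'] conjI)
    have "inj_on g' A" using g(1) g'A by (simp add: inj_on_def)
    then show "inj_on g' (insert (pfst y) A)" using f img g'y by simp
    show "g' ` insert (pfst y) A = insert (psnd y) B" using img g'y by simp
    show "card (insert (pfst y) A) = Suc (pfst s)" using f(1) g(3) \<open>finite A\<close> by simp
    show "\<forall>x\<in>insert (pfst y) A. bad (2 ^ Suc N) t c x (g' x)" using g(4) f(3) g'A g'y by simp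
    show "\<forall>x\<in>insert (pfst y) A. \<exists>i<Suc (pfst s). greedy (npair t (npair N (2 * i + 1))) c x"
      using g(5) gr(1) less_Suc_eq by blast
    show "\<forall>x\<in>insert (psnd y) B. \<exists>i<Suc (pfst s). greedy (npair t (npair N (2 * i + 2))) c x"
      using g(6) gr(2) less_Suc_eq by blast
  qed
qed

lemma reach_bound: 
  assumes "reach N t c s" shows "pfst s < 2 ^ t"
proof -
  from reach_invariant[OF assms] obtain g where
    "inj_on g (set_decode (pfst (psnd s)))" "card (set_decode (pfst (psnd s))) = pfst s"
    "\<forall>x \<in> set_decode (pfst (psnd s)). bad (2 ^ Suc N) t c x (g x)" by blast
  then show ?thesis using card_bad_matching[of g "set_decode (pfst (psnd s))" "2 ^ Suc N" t c] by auto
qed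

text \<open>The counters are bounded, so some reachable configuration has the maximal one. No fresh
  bad pair is left there, hence \<open>a\<close> or \<open>b\<close> is already matched.\<close>

lemma bad_greedy:
  assumes "bad (2 ^ Suc N) t c a b"
  shows "\<exists>i. Suc i < 2 ^ t \<and> (greedy (npair t (npair N (2 * i + 1))) c a \<or>
    greedy (npair t (npair N (2 * i + 2))) c b)"
proof -
  have 0: "reach N t c (prod_encode (0, prod_encode (0, 0)))" by (simp add: reach_def)
  define J where "J = Max (pfst ` {s. reach N t c s})"
  have fin: "finite (pfst ` {s. reach N t c s})"
    by (rule finite_subset[of _ "{..<2 ^ t}"]) (auto simp: reach_bound)
  then have "J \<in> pfst ` {s. reach N t c s}" unfolding J_def using 0 by (intro Max_in) auto
  then obtain s where s: "reach N t c s" "J = pfst s" by blast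
  define A B where "A = pfst (psnd s)" and "B = psnd (psnd s)"
  have "\<not> fresh_bad (prod_encode (a, b)) (state N t c A B)"
  proof
    assume "fresh_bad (prod_encode (a, b)) (state N t c A B)"
    from pick_total[OF this] obtain y where "chosen N t c s y" unfolding chosen_def A_def B_def ..
    then obtain s' where s': "step N t c s s'" "pfst s' = Suc (pfst s)"
      unfolding step_def using pfst_encode by blast
    then have "reach N t c s'" using s(1) unfolding reach_def by simp
    then have "pfst s' \<le> J" unfolding J_def using fin by (intro Max_ge) auto
    then show False using s' s by simp
  qed
  then have "a \<in> set_decode A \<or> b \<in> set_decode B" using assms by (auto simp: fresh_bad_state)
  then obtain i where "i < pfst s" "greedy (npair t (npair N (2 * i + 1))) c a \<or>
    greedy (npair t (npair N (2 * i + 2))) c b"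
    using reach_invariant[OF s(1)] unfolding A_def B_def by blast
  then show ?thesis using reach_bound[OF s(1)] by (intro exI[of _ i]) auto
qed

lemma bad_K:
  "\<exists>k. \<forall>N t c a b. bad (2 ^ Suc N) t c a b \<longrightarrow>
    0 < t \<and> min (K a c) (K b c) < 2 * len t + 2 * len N + t + k"
proof -
  obtain k where k: "\<And>p c z. greedy p c z \<Longrightarrow> K z c \<le> len p + k"
    using K_le_simulate[of greedy] re_greedy greedy_functional by metis
  \<comment> \<open>The 5 consists of two separators of length 2 and the bit that selects the
    component.\<close>
  have "0 < t \<and> min (K a c) (K b c) < 2 * len t + 2 * len N + t + (k + 5)"
    if bad: "bad (2 ^ Suc N) t c a b" for N t c a b
  proof -
    obtain i where i: "len i < t" "greedy (npair t (npair N (2 * i + 1))) c a \<or>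
      greedy (npair t (npair N (2 * i + 2))) c b"
      using bad_greedy[OF bad] unfolding len_less_iff by blast
    have "min (K a c) (K b c) \<le> 2 * len t + 2 + (2 * len N + 2 + Suc (len i)) + k"
      using i(2) k unfolding len_npair[symmetric] len_simps[symmetric]
      by (metis len_npair len_simps(2,3) min.coboundedI1 min.coboundedI2)
    then show ?thesis using i(1) by linarith
  qed
  then show ?thesis by blast
qed

end

section \<open>Choice of the table and logarithmic error bounds\<close>

theorem theorem2:
  fixes D :: "bool list \<Rightarrow> bool list \<Rightarrow> bool list option"
  assumes "optimal_mode D"
  shows "\<exists>C::real. \<forall>N::nat. \<forall>a b c :: bool list.
           N \<ge> 2 \<and> length a \<le> N \<and> length b \<le> N \<and> length c \<le> N \<longrightarrow>
           (\<exists>f :: bool list.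
              real (KS D b (pair_str a f)) \<le> C * log 2 N \<and>
              \<bar>real (KS D b (pair_str c f)) - real (min (KS D a c) (KS D b c))\<bar> \<le> C * log 2 N)"
proof -
  interpret optimal D by unfold_locales (rule assms)
  obtain k0 where k0: "\<And>z y. K z y \<le> len z + k0" using K_le_len by blast
  obtain k1 where k1: "\<And>a f. K (look f a) (npair a f) \<le> k1" using K_look_arg by blast
  obtain k2 where k2: "\<And>b c f. K b (npair c f) \<le> K b c + k2"
    "\<And>a c f. K (look f a) (npair c f) \<le> K a c + k2" using K_look_cond by blast
  obtain k3 where k3: "\<And>N t c a b. bad (2 ^ Suc N) t c a b \<Longrightarrow>
    0 < t \<and> min (K a c) (K b c) < 2 * len t + 2 * len N + t + k3" using bad_K by blast
  \<comment> \<open>The first two terms come from the bound on \<open>len (N + m)\<close> shown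
    below, with \<open>m = k0\<close> and \<open>m = 0\<close>, each length occurring twice.\<close>
  define C where "C = 2 * (1 + log 2 (k0 + 2)) + 2 * (1 + log 2 2) + real k3 + real k1 + real k2"
  have K: "KS D x y = K (nat_of_bits x) (nat_of_bits y)" for x y by (simp add: K_def)
  have L: "length x = len (nat_of_bits x)" for x by (simp add: len_def)
  have main: "\<exists>F. K b (npair a F) \<le> k1 \<and>
      K b (npair c F) \<le> min (K a c) (K b c) + k2 \<and>
      min (K a c) (K b c) \<le> K b (npair c F) + (2 * len (N + k0) + 2 * len N + k3)"
    if len: "len a \<le> N" "len b \<le> N" for N a b c
  proof -
    \<comment> \<open>All codes of strings of length at most \<open>N\<close> lie below
      \<open>n\<close>. The gap \<open>d\<close> covers the overhead of describing a component of a
      bad pair.\<close>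
    define k d t n :: nat where "k = min (K a c) (K b c)" and "d = 2 * len (N + k0) + 2 * len N + k3"
      and "t = k - d" and "n = 2 ^ Suc N"
    have "k \<le> N + k0" using k0[of b c] len unfolding k_def by linarith
    then have "len t \<le> len (N + k0)" unfolding t_def by (intro len_mono) simp
    \<comment> \<open>Badness would give \<open>0 < t\<close>, so the subtraction is not truncated
      and \<open>k = t + d\<close>, while \<open>k3\<close> would give
      \<open>k < t + d\<close>.\<close>
    then have "\<not> bad n t c a b"
      using k3[of N t c a b] unfolding n_def d_def k_def[symmetric] t_def by linarith
    moreover have "a < n" "b < n"
      using len len_less_iff[of a "Suc N"] len_less_iff[of b "Suc N"] unfolding n_def by simp_all
    ultimately obtain u where u: "dig n u a = b"
      "\<And>p. U p (npair c (prod_encode (n, u))) b \<Longrightarrow> \<not> Suc p < 2 ^ t"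
      unfolding bad_def by blast
    define F where "F = prod_encode (n, u)"
    have b: "look F a = b" using u(1) by (simp add: F_def look_def)
    obtain p where "U p (npair c F) b" "len p = K b (npair c F)" using K_attained by blast
    then have "t \<le> K b (npair c F)" using u(2) len_less_iff[of p t] unfolding F_def by force
    then have "k \<le> K b (npair c F) + d" unfolding t_def by linarith
    moreover have "K b (npair a F) \<le> k1" using k1[of F a] b by simp
    moreover have "K b (npair c F) \<le> k + k2"
      using k2(1)[of b c F] k2(2)[of F a c] b unfolding k_def by simp
    ultimately show ?thesis unfolding k_def d_def by blast
  qed
  have bound: "real k1 \<le> C * log 2 N \<and> real k2 \<le> C * log 2 N \<and>
      real (2 * len (N + k0) + 2 * len N + k3) \<le> C * log 2 N" if N: "2 \<le> N" for N :: nat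
  proof -
    define l where "l = log 2 (real N)"
    have l: "1 \<le> l" using N by (simp add: l_def le_log_iff)
    have len: "real (len (N + m)) \<le> (1 + log 2 (m + 2)) * l" for m :: nat
    proof -
      have "real (len (N + m)) \<le> log 2 (real (N + m) + 1)" by (rule len_le_log)
      also have "\<dots> \<le> log 2 (real (m + 2) * real N)"
      proof -
        have "N + m + 1 \<le> (m + 2) * N" using N by (cases N) auto
        then have "real (N + m + 1) \<le> real ((m + 2) * N)" using of_nat_le_iff by blast
        then show ?thesis using N by (simp add: algebra_simps)
      qed
      also have "\<dots> = log 2 (m + 2) + l" using N by (simp add: log_mult l_def)
      \<comment> \<open>Since \<open>l\<close> is at least 1, the constant is absorbed into a
        multiple of \<open>l\<close>; this is where \<open>N\<close> being at least 2
        matters.\<close>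
      also have "\<dots> \<le> log 2 (m + 2) * l + l"
        using l mult_left_mono[of 1 l "log 2 (m + 2)"] by simp
      finally show ?thesis by (simp add: algebra_simps)
    qed
    have k: "real m \<le> real m * l" for m using l by (simp add: mult_le_cancel_left1)
    have nn: "0 \<le> log 2 (real (k0 + 2)) * l" "0 \<le> log 2 (2::real) * l" using l by simp_all
    have "C * l = 2 * ((1 + log 2 (k0 + 2)) * l) + 2 * ((1 + log 2 2) * l) + real k3 * l + real k1 * l + real k2 * l"
      by (simp add: C_def algebra_simps)
    then show ?thesis
      using len[of k0] len[of 0] k[of k1] k[of k2] k[of k3] nn l
      unfolding l_def[symmetric] by (simp add: algebra_simps)
  qed
  show ?thesis
  proof (intro exI[of _ C] allI impI, elim conjE)
    fix N :: nat and a b c :: "bool list"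
    assume N: "2 \<le> N" and len: "length a \<le> N" "length b \<le> N"
    obtain F where F: "KS D b (pair_str a (bits_of_nat F)) \<le> k1"
      "KS D b (pair_str c (bits_of_nat F)) \<le> min (KS D a c) (KS D b c) + k2"
      "min (KS D a c) (KS D b c)
        \<le> KS D b (pair_str c (bits_of_nat F)) + (2 * len (N + k0) + 2 * len N + k3)"
      using main[of "nat_of_bits a" N "nat_of_bits b" "nat_of_bits c"] len
      unfolding K L by (auto simp: npair_def)
    have "real (KS D b (pair_str a (bits_of_nat F))) \<le> C * log 2 N"
      using F(1) bound[OF N] by linarith
    moreover have "\<bar>real (KS D b (pair_str c (bits_of_nat F))) - real (min (KS D a c) (KS D b c))\<bar>
        \<le> C * log 2 N"
      using F(2,3) bound[OF N] by linarith
    ultimately show "\<exists>f. real (KS D b (pair_str a f)) \<le> C * log 2 N \<and>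
        \<bar>real (KS D b (pair_str c f)) - real (min (KS D a c) (KS D b c))\<bar> \<le> C * log 2 N"
      by blast
  qed
qed

end
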